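(* Let $p$ be a prime, let $d\ge2$, and let $G$ be the group $\langle 1+\overline x_1,\dots,1+\overline x_d\rangle$ of invertible elements of the algebra $B=A/\mathcal I$ obtained by the (Golod) construction described in the context. Then $G$ is a finitely generated residually finite $p$-group of uniformly exponential growth.
   Context: Construction. Let $A=\bigoplus_{n\ge0}A_n$ be the free associative (unital) algebra over $\mathbb F_p$ on $x_1,\dots,x_d$, where $A_n$ is spanned by the monomials of degree $n$ and $A_0=\mathbb F_p1$. Enumerate as $\{y_k\}_{k=1}^\infty$ all elements of $A$ with zero constant term. Put $\mathcal I_0=0$. Inductively for $k\ge1$: if the image of $y_k$ in $A/\mathcal I_{k-1}$ is nilpotent, put $\mathcal I_k=\mathcal I_{k-1}$; otherwise choose $\ell_k\ge3$ sufficiently large that the least degree of the monomials occurring in $y_k^{p^{\ell_k}}$ is larger than all degrees of monomials occurring in the generators previously chosen for $\mathcal I_{k-1}$, and let $\mathcal I_k$ be the two-sided ideal generated by $\mathcal I_{k-1}$ together with all homogeneous parts of the polynomial $y_k^{p^{\ell_k}}$. Let $\mathcal I=\bigcup_{k\ge0}\mathcal I_k$ and $B=A/\mathcal I$, a graded algebra. Let $\overline x_1,\dots,\overline x_d$ be the images of $x_1,\dots,x_d$ in $B$; they are nilpotent, so the elements $s_i=1+\overline x_i$ are invertible in $B$, and $G$ is the group generated by $s_1,\dots,s_d$. A $p$-group is a group in which every element has order a power of $p$. For a finitely generated group $G$ and a finite generating set $S$ let $\gamma_G^S(n)$ be the number of elements of $G$ that are products of at most $n$ generators from $S$ ($S$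 being a generating set as a semigroup), $\omega_G^S=\lim_{n\to\infty}\sqrt[n]{\gamma_G^S(n)}$ and $\omega_G=\inf_S\omega_G^S$ over all finite generating sets $S$; $G$ has uniformly exponential growth if $\omega_G>1$. *)

theory Defs
  imports
    "HOL-Algebra.Algebra"
    "HOL-Algebra.Algebraic_Closure_Type"
    "HOL-Library.Poly_Mapping"
    "Berlekamp_Zassenhaus.Finite_Field"
begin

section \<open>The free associative algebra over the prime field\<close>

text \<open>
  The free monoid on \<^typ>\<open>'d\<close>, written additively because the convolution product of
  \<^theory>\<open>HOL-Library.Poly_Mapping\<close> expects an additive (not necessarily commutative) monoid
  of exponents. Thus \<open>+\<close> is concatenation and \<open>0\<close> is the empty word.
\<close>

datatype 'd monomial = Monomial (letters: "'d list")

instantiation monomial :: (type) monoid_add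
begin

definition zero_monomial :: "'d monomial"
  where "zero_monomial = Monomial []"

definition plus_monomial :: "'d monomial \<Rightarrow> 'd monomial \<Rightarrow> 'd monomial"
  where "plus_monomial u v = Monomial (letters u @ letters v)"

instance
  by standard (simp_all add: zero_monomial_def plus_monomial_def)

end

definition mdegree :: "'d monomial \<Rightarrow> nat"
  where "mdegree w = length (letters w)"

text \<open>
  \<^typ>\<open>'p mod_ring\<close> with \<open>'p :: prime_card\<close> is the field with \<open>p = CARD('p)\<close> elements, and
  \<^typ>\<open>'d\<close> indexes the free generators, so \<open>d = CARD('d)\<close>.
\<close>

type_synonym ('d, 'p) free_algebra = "'d monomial \<Rightarrow>\<^sub>0 'p mod_ring"

abbreviation free_algebra_ring :: "('d, 'p::prime_card) free_algebra ring"
  where "free_algebra_ring \<equiv> ring_of_type_algebra"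

definition gen :: "'d \<Rightarrow> ('d, 'p::prime_card) free_algebra"
  where "gen i = Poly_Mapping.single (Monomial [i]) 1"

definition constant_term :: "('d, 'p::prime_card) free_algebra \<Rightarrow> 'p mod_ring"
  where "constant_term a = Poly_Mapping.lookup a 0"

definition homogeneous_part ::
    "nat \<Rightarrow> ('d, 'p::prime_card) free_algebra \<Rightarrow> ('d, 'p) free_algebra"
  where "homogeneous_part n a =
    (\<Sum>w \<in> {w \<in> Poly_Mapping.keys a. mdegree w = n}.
       Poly_Mapping.single w (Poly_Mapping.lookup a w))"

definition homogeneous_parts ::
    "('d, 'p::prime_card) free_algebra \<Rightarrow> ('d, 'p) free_algebra set"
  where "homogeneous_parts a = range (\<lambda>n. homogeneous_part n a)"


section \<open>The Golod construction\<close>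

definition nilpotent_in :: "('a, 'b) ring_scheme \<Rightarrow> 'a \<Rightarrow> bool"
  where "nilpotent_in R x \<longleftrightarrow> (\<exists>n::nat. x [^]\<^bsub>R\<^esub> n = \<zero>\<^bsub>R\<^esub>)"

definition nilpotent_mod ::
    "('d, 'p::prime_card) free_algebra set \<Rightarrow> ('d, 'p) free_algebra \<Rightarrow> bool"
  where "nilpotent_mod I a \<longleftrightarrow>
    nilpotent_in (free_algebra_ring Quot I) (I +>\<^bsub>free_algebra_ring\<^esub> a)"

definition relator_source ::
    "(nat \<Rightarrow> ('d, 'p::prime_card) free_algebra) \<Rightarrow> (nat \<Rightarrow> nat) \<Rightarrow> nat \<Rightarrow> ('d, 'p) free_algebra"
  where "relator_source y l k = y k ^ (CARD('p) ^ l k)"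

text \<open>
  The enumeration \<open>y\<close> and the exponents \<open>l\<close> are used at indices \<open>k \<ge> 1\<close> only; the exponent
  \<open>l k\<close> is ignored when \<open>y k\<close> is nilpotent modulo the previous ideal.
\<close>

primrec golod_stage ::
    "(nat \<Rightarrow> ('d, 'p::prime_card) free_algebra) \<Rightarrow> (nat \<Rightarrow> nat) \<Rightarrow> nat \<Rightarrow> ('d, 'p) free_algebra set"
  where
    "golod_stage y l 0 = {0}"
  | "golod_stage y l (Suc k) =
      (if nilpotent_mod (golod_stage y l k) (y (Suc k))
       then golod_stage y l k
       else Idl\<^bsub>free_algebra_ring\<^esub>
              (golod_stage y l k \<union> homogeneous_parts (relator_source y l (Suc k))))"

primrec golod_relators ::
    "(nat \<Rightarrow> ('d, 'p::prime_card) free_algebra) \<Rightarrow> (nat \<Rightarrow> nat) \<Rightarrow> nat \<Rightarrow> ('d, 'p) free_algebra set"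
  where
    "golod_relators y l 0 = {}"
  | "golod_relators y l (Suc k) =
      (if nilpotent_mod (golod_stage y l k) (y (Suc k))
       then golod_relators y l k
       else golod_relators y l k \<union> homogeneous_parts (relator_source y l (Suc k)))"

definition golod_data ::
    "(nat \<Rightarrow> ('d, 'p::prime_card) free_algebra) \<Rightarrow> (nat \<Rightarrow> nat) \<Rightarrow> bool"
  where "golod_data y l \<longleftrightarrow>
    y ` {1..} = {a. constant_term a = 0} \<and>
    (\<forall>k. \<not> nilpotent_mod (golod_stage y l k) (y (Suc k)) \<longrightarrow>
       l (Suc k) \<ge> 3 \<and>
       (\<forall>w \<in> Poly_Mapping.keys (relator_source y l (Suc k)).
          \<forall>r \<in> golod_relators y l k. \<forall>v \<in> Poly_Mapping.keys r. mdegree v < mdegree w))"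

definition golod_ideal ::
    "(nat \<Rightarrow> ('d, 'p::prime_card) free_algebra) \<Rightarrow> (nat \<Rightarrow> nat) \<Rightarrow> ('d, 'p) free_algebra set"
  where "golod_ideal y l = (\<Union>k. golod_stage y l k)"

definition golod_algebra ::
    "(nat \<Rightarrow> ('d, 'p::prime_card) free_algebra) \<Rightarrow> (nat \<Rightarrow> nat) \<Rightarrow> ('d, 'p) free_algebra set ring"
  where "golod_algebra y l = free_algebra_ring Quot golod_ideal y l"

definition golod_generator ::
    "(nat \<Rightarrow> ('d, 'p::prime_card) free_algebra) \<Rightarrow> (nat \<Rightarrow> nat) \<Rightarrow> 'd \<Rightarrow> ('d, 'p) free_algebra set"
  where "golod_generator y l i =
    \<one>\<^bsub>golod_algebra y l\<^esub> \<oplus>\<^bsub>golod_algebra y l\<^esub>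
      (golod_ideal y l +>\<^bsub>free_algebra_ring\<^esub> gen i)"

text \<open>
  \<^const>\<open>subgroup_generated\<close> intersects the generating set with the carrier; for Golod data this
  discards nothing, by lemma \<open>golod_generator_unit\<close> below.
\<close>

definition golod_group ::
    "(nat \<Rightarrow> ('d, 'p::prime_card) free_algebra) \<Rightarrow> (nat \<Rightarrow> nat) \<Rightarrow> ('d, 'p) free_algebra set monoid"
  where "golod_group y l =
    subgroup_generated (units_of (golod_algebra y l)) (range (golod_generator y l))"

lemma ring_free_algebra: "ring (free_algebra_ring :: ('d, 'p::prime_card) free_algebra ring)"
proof -
  have "\<exists>b. a + b = 0 \<and> b + a = 0" for a :: "('d, 'p) free_algebra"
    by (rule exI[of _ "- a"]) simp
  then show ?thesis
    unfolding ring_of_type_algebra_def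
    by unfold_locales (simp_all add: add_ac distrib_left distrib_right mult.assoc Units_def)
qed

lemma carrier_free_algebra [simp]: "carrier free_algebra_ring = UNIV"
  by (simp add: ring_of_type_algebra_def)

lemma pow_free_algebra: "a [^]\<^bsub>free_algebra_ring\<^esub> (n::nat) = a ^ n"
proof (induction n)
  case 0
  then show ?case by (simp add: ring_of_type_algebra_def)
next
  case (Suc n)
  then show ?case
    by (simp add: ring_of_type_algebra_def power_commutes)
qed

lemma ideal_golod_stage: "ideal (golod_stage y l k) free_algebra_ring"
proof (induction k)
  case 0
  show ?case
    using ring.zeroideal[OF ring_free_algebra] by (simp add: ring_of_type_algebra_def)
next
  case (Suc k)
  then show ?case
    by (simp add: ring.genideal_ideal[OF ring_free_algebra])
qed

lemma golod_stage_Suc: "golod_stage y l k \<subseteq> golod_stage y l (Suc k)"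
  using ring.genideal_self[OF ring_free_algebra,
      of "golod_stage y l k \<union> homogeneous_parts (relator_source y l (Suc k))"]
  by auto

lemma golod_stage_mono: "j \<le> k \<Longrightarrow> golod_stage y l j \<subseteq> golod_stage y l k"
  by (rule lift_Suc_mono_le[of "golod_stage y l"]) (rule golod_stage_Suc)

lemma ideal_golod_ideal: "ideal (golod_ideal y l) free_algebra_ring"
proof -
  have "golod_stage y l j \<subseteq> golod_stage y l k \<or> golod_stage y l k \<subseteq> golod_stage y l j" for j k
    using golod_stage_mono[of j k y l] golod_stage_mono[of k j y l] nat_le_linear[of j k] by blast
  then have "subset.chain {I. ideal I free_algebra_ring} (range (golod_stage y l))"
    using ideal_golod_stage[of y l] unfolding subset_chain_def by blast
  then show ?thesis
    using ring.chain_Union_is_ideal[OF ring_free_algebra, of "range (golod_stage y l)"]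
    by (simp add: golod_ideal_def)
qed

lemma ring_golod_algebra: "ring (golod_algebra y l)"
  unfolding golod_algebra_def by (rule ideal.quotient_is_ring[OF ideal_golod_ideal])

lemma nilpotent_mod_iff:
  assumes "ideal I free_algebra_ring"
  shows "nilpotent_mod I a \<longleftrightarrow> (\<exists>n. a ^ n \<in> I)"
proof -
  interpret ideal I free_algebra_ring by fact
  interpret Q: ring "free_algebra_ring Quot I" by (rule quotient_is_ring)
  interpret H: ring_hom_ring free_algebra_ring "free_algebra_ring Quot I" "(+>\<^bsub>free_algebra_ring\<^esub>) I"
    by (rule rcos_ring_hom_ring)
  have "(I +>\<^bsub>free_algebra_ring\<^esub> a) [^]\<^bsub>free_algebra_ring Quot I\<^esub> n
      = I +>\<^bsub>free_algebra_ring\<^esub> (a ^ n)" for n :: nat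
    using H.hom_nat_pow[of a n] by (simp add: pow_free_algebra)
  moreover have "I +>\<^bsub>free_algebra_ring\<^esub> b = I \<longleftrightarrow> b \<in> I" for b
    using a_rcos_const[of b] a_rcos_self[of b] by auto
  moreover have "\<zero>\<^bsub>free_algebra_ring Quot I\<^esub> = I"
    unfolding FactRing_def by (rule ring.simps)
  ultimately show ?thesis
    unfolding nilpotent_mod_def nilpotent_in_def by metis
qed

lemma gen_power: "(gen i :: ('d, 'p::prime_card) free_algebra) ^ m = Poly_Mapping.single (Monomial (replicate m i)) 1"
proof (induction m)
  case 0
  show ?case by (simp flip: zero_monomial_def)
next
  case (Suc m)
  have "(gen i :: ('d, 'p) free_algebra) ^ Suc m = gen i * gen i ^ m"
    by simp
  also have "\<dots> = Poly_Mapping.single (Monomial (replicate (Suc m) i)) 1"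
    unfolding Suc by (simp add: gen_def mult_single plus_monomial_def)
  finally show ?case .
qed

lemma homogeneous_part_gen_power:
  "homogeneous_part m (gen i ^ m) = (gen i ^ m :: ('d, 'p::prime_card) free_algebra)"
proof -
  have "{w \<in> Poly_Mapping.keys (gen i ^ m :: ('d, 'p) free_algebra). mdegree w = m} = {Monomial (replicate m i)}"
    by (auto simp: gen_power mdegree_def)
  then show ?thesis
    by (simp add: homogeneous_part_def gen_power)
qed

lemma gen_nilpotent:
  fixes y :: "nat \<Rightarrow> ('d, 'p::prime_card) free_algebra"
  assumes "golod_data y l"
  shows "\<exists>n. gen i ^ n \<in> golod_ideal y l"
proof -
  have "constant_term (gen i :: ('d, 'p) free_algebra) = 0"
    by (simp add: constant_term_def gen_def zero_monomial_def lookup_single)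
  then have "gen i \<in> y ` {1..}"
    using assms by (simp add: golod_data_def)
  then obtain k' where k': "k' \<ge> 1" "y k' = gen i"
    by auto
  then obtain k where "k' = Suc k"
    by (cases k') auto
  with k' have k: "y (Suc k) = gen i"
    by simp
  have "\<exists>n. gen i ^ n \<in> golod_stage y l (Suc k)"
  proof (cases "nilpotent_mod (golod_stage y l k) (y (Suc k))")
    case True
    then show ?thesis
      using k by (simp add: nilpotent_mod_iff[OF ideal_golod_stage])
  next
    case False
    let ?m = "CARD('p) ^ l (Suc k)"
    let ?S = "golod_stage y l k \<union> homogeneous_parts (relator_source y l (Suc k))"
    have "gen i ^ ?m \<in> homogeneous_parts (relator_source y l (Suc k))"
      unfolding homogeneous_parts_def relator_source_def k
      using homogeneous_part_gen_power[of ?m i] by (metis rangeI)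
    then have "gen i ^ ?m \<in> golod_stage y l (Suc k)"
      using False ring.genideal_self[OF ring_free_algebra, of ?S] by auto
    then show ?thesis ..
  qed
  then show ?thesis
    by (auto simp: golod_ideal_def simp del: golod_stage.simps)
qed

lemma one_plus_inverse_mod_power:
  fixes x :: "'r::ring_1"
  shows "\<exists>z. (1 + x) * z = 1 - (- x) ^ n \<and> z * (1 + x) = 1 - (- x) ^ n"
proof (induction n)
  case 0
  show ?case by (rule exI[of _ 0]) simp
next
  case (Suc n)
  then obtain z where z: "(1 + x) * z = 1 - (- x) ^ n" "z * (1 + x) = 1 - (- x) ^ n"
    by blast
  have "(1 + x) * (z + (- x) ^ n) = 1 - (- x) ^ Suc n"
    by (simp add: distrib_left z(1)) (simp add: distrib_right)
  moreover have "(z + (- x) ^ n) * (1 + x) = 1 - (- x) ^ Suc n"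
    by (simp add: distrib_right z(2)) (simp add: distrib_left power_commutes[of "- x", simplified])
  ultimately show ?case by blast
qed

lemma golod_generator_unit:
  fixes y :: "nat \<Rightarrow> ('d, 'p::prime_card) free_algebra"
  assumes "golod_data y l"
  shows "golod_generator y l i \<in> carrier (units_of (golod_algebra y l))"
proof -
  define A :: "('d, 'p) free_algebra ring" where "A = free_algebra_ring"
  define I where "I = golod_ideal y l"
  define B where "B = golod_algebra y l"
  define x :: "('d, 'p) free_algebra" where "x = gen i"
  define q where "q = (\<lambda>a. I +>\<^bsub>A\<^esub> a)"
  have A: "carrier A = UNIV" "a \<oplus>\<^bsub>A\<^esub> b = a + b" "a \<otimes>\<^bsub>A\<^esub> b = a * b" "\<one>\<^bsub>A\<^esub> = 1" for a b
    by (simp_all add: A_def ring_of_type_algebra_def)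
  have I: "ideal I A"
    unfolding I_def A_def by (rule ideal_golod_ideal)
  have B: "B = A Quot I"
    by (simp add: B_def golod_algebra_def A_def I_def)
  have "ring_hom_ring A B q"
    unfolding B q_def by (rule ideal.rcos_ring_hom_ring[OF I])
  note q = ring_hom_ring.homh[OF this]
  have q_carrier: "q a \<in> carrier B" for a
    using ring_hom_closed[OF q] A by blast
  have q_add: "q (a + b) = q a \<oplus>\<^bsub>B\<^esub> q b" and q_mult: "q (a * b) = q a \<otimes>\<^bsub>B\<^esub> q b" for a b
    using ring_hom_add[OF q, of a b] ring_hom_mult[OF q, of a b] A by simp_all
  have q_one: "q 1 = \<one>\<^bsub>B\<^esub>"
    using ring_hom_one[OF q] A by simp
  obtain n where "x ^ n \<in> I"
    using gen_nilpotent[OF assms] unfolding x_def I_def by blast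
  then have "(- 1) ^ n \<otimes>\<^bsub>A\<^esub> x ^ n \<in> I"
    using ideal.I_l_closed[OF I] A(1) by blast
  then have "(- x) ^ n \<in> I"
    unfolding A power_minus[of x] .
  then have "q ((- x) ^ n) = I"
    unfolding q_def
    by (rule abelian_subgroup.a_rcos_const[OF abelian_subgroupI3[OF ideal.axioms(1)[OF I]
          ring.is_abelian_group[OF ideal.axioms(2)[OF I]]]])
  then have q_pow: "q ((- x) ^ n) = \<zero>\<^bsub>B\<^esub>"
    by (simp add: B FactRing_def)
  obtain z where z: "(1 + x) * z = 1 - (- x) ^ n" "z * (1 + x) = 1 - (- x) ^ n"
    using one_plus_inverse_mod_power[of x n] by blast
  have "ring B"
    unfolding B by (rule ideal.quotient_is_ring[OF I])
  have "\<one>\<^bsub>B\<^esub> = q ((1 - (- x) ^ n) + (- x) ^ n)"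
    by (simp add: q_one)
  also have "\<dots> = q (1 - (- x) ^ n)"
    unfolding q_add q_pow
    by (rule abelian_monoid.r_zero[OF abelian_group.axioms(1)[OF ring.is_abelian_group[OF \<open>ring B\<close>]]
          q_carrier])
  finally have "q (1 + x) \<otimes>\<^bsub>B\<^esub> q z = \<one>\<^bsub>B\<^esub>" "q z \<otimes>\<^bsub>B\<^esub> q (1 + x) = \<one>\<^bsub>B\<^esub>"
    by (simp_all flip: q_mult add: z)
  then have "q (1 + x) \<in> Units B"
    using q_carrier unfolding Units_def by blast
  moreover have "golod_generator y l i = q (1 + x)"
    unfolding q_add q_one by (simp add: golod_generator_def B_def q_def I_def A_def x_def)
  ultimately show ?thesis
    by (simp add: units_of_def B_def)
qed


section \<open>Group-theoretic notions\<close>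

definition finitely_generated_group :: "('a, 'b) monoid_scheme \<Rightarrow> bool"
  where "finitely_generated_group G \<longleftrightarrow>
    group G \<and> (\<exists>S. finite S \<and> S \<subseteq> carrier G \<and> generate G S = carrier G)"

definition residually_finite_group :: "('a, 'b) monoid_scheme \<Rightarrow> bool"
  where "residually_finite_group G \<longleftrightarrow>
    group G \<and>
    (\<forall>g \<in> carrier G. g \<noteq> \<one>\<^bsub>G\<^esub> \<longrightarrow> (\<exists>N. N \<lhd> G \<and> finite (rcosets\<^bsub>G\<^esub> N) \<and> g \<notin> N))"

text \<open>
  \<^const>\<open>group.ord\<close> is \<open>0\<close> on elements of infinite order, so these are excluded for \<open>p > 0\<close>.
\<close>

definition p_group :: "nat \<Rightarrow> ('a, 'b) monoid_scheme \<Rightarrow> bool"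
  where "p_group p G \<longleftrightarrow> group G \<and> (\<forall>g \<in> carrier G. \<exists>k. group.ord G g = p ^ k)"

definition word_product :: "('a, 'b) monoid_scheme \<Rightarrow> 'a list \<Rightarrow> 'a"
  where "word_product G ws = foldr (\<otimes>\<^bsub>G\<^esub>) ws \<one>\<^bsub>G\<^esub>"

definition semigroup_generating_set :: "('a, 'b) monoid_scheme \<Rightarrow> 'a set \<Rightarrow> bool"
  where "semigroup_generating_set G S \<longleftrightarrow>
    S \<subseteq> carrier G \<and> carrier G = {word_product G ws | ws. ws \<in> lists S \<and> ws \<noteq> []}"

definition growth_function :: "('a, 'b) monoid_scheme \<Rightarrow> 'a set \<Rightarrow> nat \<Rightarrow> nat"
  where "growth_function G S n = card {word_product G ws | ws. ws \<in> lists S \<and> length ws \<le> n}"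

definition growth_rate :: "('a, 'b) monoid_scheme \<Rightarrow> 'a set \<Rightarrow> real"
  where "growth_rate G S = lim (\<lambda>n. root n (real (growth_function G S n)))"

definition minimal_growth_rate :: "('a, 'b) monoid_scheme \<Rightarrow> real"
  where "minimal_growth_rate G =
    Inf {growth_rate G S | S. finite S \<and> semigroup_generating_set G S}"

text \<open>
  Finite generation ensures that the infimum is not taken over the empty set.
\<close>

definition uniformly_exponential_growth :: "('a, 'b) monoid_scheme \<Rightarrow> bool"
  where "uniformly_exponential_growth G \<longleftrightarrow>
    finitely_generated_group G \<and> minimal_growth_rate G > 1"

end

theory Submission
  imports Defs
begin

text \<open>
  Every relator is a homogeneous part of some \<open>y k ^ (p ^ l k)\<close>. Since \<open>y k\<close> has no constant term and
  \<open>l k \<ge> 3\<close>, a nonzero relator has degree at least \<open>p ^ 3 \<ge> 8\<close>, and since each new power starts above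
  all earlier relators, there is at most one nonzero relator in each degree (\<open>golod_relator_unique\<close>).
  The estimate for the quotient by the ideal \<open>J\<close> generated by the relators rests on this sparsity.

  Golod--Shafarevich. An element of degree \<open>n\<close> in \<open>J\<close> is a sum of left multiples \<open>x\<^sub>j * g\<close> with \<open>g \<in> J\<close>
  and of right multiples \<open>r\<^sub>i * c\<close> of relators, and \<open>c\<close> matters only modulo \<open>J\<close>. For the dimension \<open>b n\<close>
  of the degree \<open>n\<close> part of the quotient this gives \<open>d * b n \<le> b (n+1) + (\<Sum>i=8..n+1. b (n+1-i))\<close>,
  which forces \<open>b n \<ge> (3/2)^n\<close> once \<open>d \<ge> 2\<close>. The base field being finite, dimensions are replaced by
  logarithms of numbers of cosets (\<open>card_reps_Suc\<close>, \<open>reps_exponential_growth\<close>).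

  Uniform growth. Let \<open>S\<close> be any finite generating set of \<open>G\<close>. Sending \<open>1 + (terms of positive degree)\<close>
  to its linear part turns products into sums, so the linear parts of the elements of \<open>S\<close> span the
  linear forms. Combinations of products of \<open>n\<close> factors \<open>s - 1\<close> with \<open>s \<in> S\<close> then have every homogeneous
  element of degree \<open>n\<close> as a leading term, and such products
  expand into signed sums of products of at most \<open>n\<close> elements of \<open>S\<close>.
  Hence the ball of radius \<open>n\<close> spans the quotient up to degree \<open>n\<close>, it has at least \<open>b n \<ge> (3/2)^n\<close>
  elements (\<open>card_reps_le_growth\<close>), and the bound \<open>3/2\<close> for the growth rate is independent of \<open>S\<close>.

  The other two properties are softer. Each element of \<open>G\<close> is \<open>1 + a\<close> with \<open>a\<close> nilpotent, so
  \<open>(1 + a) ^ (p ^ n) = 1 + a ^ (p ^ n) = 1\<close> for large \<open>n\<close>; and as \<open>J\<close> is homogeneous, elements of \<open>G\<close> are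
  separated from \<open>1\<close> by the finite quotients that kill all degrees above a bound.
\<close>

section \<open>Growth of real sequences\<close>

text \<open>
  Fekete's lemma: the limit is the infimum \<open>L\<close> of the quotients. If \<open>a m / m\<close> is close to \<open>L\<close>, then division
  of \<open>n\<close> by \<open>m\<close> with remainder bounds \<open>a n / n\<close> by \<open>a m / m\<close> up to an error of order \<open>1 / n\<close>.
\<close>

lemma subadditive_quotient_convergent:
  fixes a :: "nat \<Rightarrow> real"
  assumes nonneg: "\<And>n. 0 \<le> a n"
    and subadd: "\<And>m n. a (m + n) \<le> a m + a n"
  shows "convergent (\<lambda>n. a n / real n)"
proof -
  define L where "L = (INF n\<in>{1..}. a n / real n)"
  have bdd: "bdd_below ((\<lambda>n. a n / real n) ` {1..})"
    by (rule bdd_belowI[of _ 0]) (auto simp: nonneg)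
  have lower: "L \<le> a n / real n" if "n \<ge> 1" for n
    unfolding L_def using that by (intro cINF_lower[OF bdd]) auto
  have multiple: "a (q * m + r) \<le> real q * a m + a r" for q m r
  proof (induction q)
    case (Suc q)
    have "a (Suc q * m + r) \<le> a m + a (q * m + r)"
      using subadd[of m "q * m + r"] by (simp add: add.assoc)
    then show ?case
      using Suc.IH by (simp add: algebra_simps)
  qed simp
  have "(\<lambda>n. a n / real n) \<longlonglongrightarrow> L"
  proof (rule LIMSEQ_I)
    fix e :: real
    assume "0 < e"
    have "\<exists>m\<in>{1..}. a m / real m < L + e / 2"
    proof (rule ccontr)
      assume "\<not> ?thesis"
      then have "L + e / 2 \<le> L"
        unfolding L_def by (intro cINF_greatest) (auto simp: not_less)
      with \<open>0 < e\<close> show False by simp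
    qed
    then obtain m where m: "m \<ge> 1" "a m / real m < L + e / 2"
      by auto
    define M where "M = Max (a ` {..<m})"
    have M: "a r \<le> M" if "r < m" for r
      unfolding M_def using that by (intro Max_ge) auto
    obtain N :: nat where N: "M / (e / 2) < real N"
      using reals_Archimedean2 by blast
    have "norm (a n / real n - L) < e" if n: "n \<ge> max 1 N" for n
    proof -
      have "a n = a (n div m * m + n mod m)"
        by simp
      also have "\<dots> \<le> real (n div m) * a m + a (n mod m)"
        by (rule multiple)
      also have "\<dots> \<le> real n / real m * a m + M"
        using m(1) by (intro add_mono mult_right_mono M nonneg)
          (auto simp: of_nat_div_le_of_nat)
      finally have "a n / real n \<le> a m / real m + M / real n"
        using n by (simp add: field_simps)
      moreover have "M / real n < e / 2"
      proof -
        have "M < e / 2 * real N"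
          using N \<open>0 < e\<close> by (simp add: field_simps)
        also have "\<dots> \<le> e / 2 * real n"
          using n \<open>0 < e\<close> by (intro mult_left_mono) auto
        finally show ?thesis
          using n by (simp add: field_simps)
      qed
      ultimately have "a n / real n - L < e"
        using m(2) by linarith
      then show ?thesis
        using lower[of n] n by (simp add: abs_if)
    qed
    then show "\<exists>no. \<forall>n\<ge>no. norm (a n / real n - L) < e"
      by blast
  qed
  then show ?thesis
    by (rule convergentI)
qed

text \<open>
  A growth rate is written with \<open>lim\<close>, which is meaningful only for a convergent sequence; for the
  growth function of a group convergence comes from submultiplicativity.
\<close>

lemma submultiplicative_root_convergent:
  fixes u :: "nat \<Rightarrow> real"
  assumes ge_1: "\<And>n. 1 \<le> u n"
    and submult: "\<And>m n. u (m + n) \<le> u m * u n"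
  shows "convergent (\<lambda>n. root n (u n))"
proof -
  have pos: "0 < u n" for n
    using ge_1[of n] by simp
  have "convergent (\<lambda>n. ln (u n) / real n)"
  proof (rule subadditive_quotient_convergent)
    show "0 \<le> ln (u n)" for n
      using ge_1 by simp
    show "ln (u (m + n)) \<le> ln (u m) + ln (u n)" for m n
    proof -
      have "ln (u (m + n)) \<le> ln (u m * u n)"
        using submult[of m n] pos[of "m + n"] by (intro ln_mono) simp_all
      also have "\<dots> = ln (u m) + ln (u n)"
        by (rule ln_mult_pos[OF pos pos])
      finally show ?thesis .
    qed
  qed
  then obtain L where "(\<lambda>n. ln (u n) / real n) \<longlonglongrightarrow> L"
    by (auto simp: convergent_def)
  then have "(\<lambda>n. exp (ln (u n) / real n)) \<longlonglongrightarrow> exp L"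
    by (rule tendsto_exp)
  moreover have "eventually (\<lambda>n. exp (ln (u n) / real n) = root n (u n)) sequentially"
    using eventually_gt_at_top[of 0]
  proof eventually_elim
    case (elim n)
    have "ln (root n (u n)) = ln (u n) / real n"
      using elim by (rule ln_root)
    moreover have "exp (ln (root n (u n))) = root n (u n)"
      using elim pos by (intro exp_ln) simp
    ultimately show ?case by simp
  qed
  ultimately have "(\<lambda>n. root n (u n)) \<longlonglongrightarrow> exp L"
    by (rule Lim_transform_eventually)
  then show ?thesis
    by (rule convergentI)
qed

text \<open>
  The hypothesis is the Golod--Shafarevich inequality for two generators and at most one relator in
  each degree from 8 on. If \<open>b\<close> has grown at least by the factor \<open>3/2\<close> in all steps up to \<open>n\<close>, the subtracted sum
  is at most \<open>b n\<close> times the tail \<open>3 * (2/3)^7 < 1/2\<close> of a geometric series, so the next step has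
  a factor of at least \<open>2 - 1/2\<close>.
\<close>

lemma golod_shafarevich_recursion_growth:
  fixes b :: "nat \<Rightarrow> real"
  assumes init: "1 \<le> b 0"
    and rec: "\<And>n. 2 * b n \<le> b (Suc n) + (\<Sum>i = 8..Suc n. b (Suc n - i))"
  shows "(3 / 2) ^ n \<le> b n"
proof -
  have partial_sum: "(\<Sum>i = 8..Suc n. q ^ (i - 1)) = 3 * q ^ 7 - 3 * q ^ Suc n"
    if "7 \<le> n" "q = 2 / 3" for n and q :: real
    using that(1)
  proof (induction n rule: dec_induct)
    case base
    show ?case using that(2) by (simp add: power_numeral_reduce)
  next
    case (step n)
    have "(\<Sum>i = 8..Suc (Suc n). q ^ (i - 1)) = (\<Sum>i = 8..Suc n. q ^ (i - 1)) + q ^ Suc n"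
      using step.hyps by simp
    also have "\<dots> = 3 * q ^ 7 - 2 * q ^ Suc n"
      unfolding step.IH by simp
    also have "\<dots> = 3 * q ^ 7 - 3 * q ^ Suc (Suc n)"
      using that(2) by simp
    finally show ?case .
  qed
  have geometric: "(\<Sum>i = 8..Suc n. (2 / 3 :: real) ^ (i - 1)) \<le> 1 / 2" for n
  proof (cases "n < 7")
    case False
    then have "(\<Sum>i = 8..Suc n. (2 / 3 :: real) ^ (i - 1)) = 3 * (2 / 3) ^ 7 - 3 * (2 / 3) ^ Suc n"
      by (intro partial_sum) simp_all
    also have "\<dots> \<le> 3 * (2 / 3) ^ 7"
      by simp
    also have "\<dots> \<le> 1 / 2"
      by (simp add: power_divide)
    finally show ?thesis .
  qed simp
  have step: "0 < b n \<and> 3 / 2 * b n \<le> b (Suc n)" for n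
  proof (induction n rule: less_induct)
    case (less n)
    have pos: "0 < b n"
    proof (cases n)
      case (Suc k)
      then show ?thesis
        using less.IH[of k] by simp
    qed (use init in simp)
    have decay: "b (n - i) \<le> (2 / 3) ^ i * b n" if "i \<le> n" for i
      using that
    proof (induction i)
      case (Suc i)
      have "3 / 2 * b (n - Suc i) \<le> b (Suc (n - Suc i))"
        using less.IH[of "n - Suc i"] Suc.prems by simp
      also have "Suc (n - Suc i) = n - i"
        using Suc.prems by simp
      also have "b (n - i) \<le> (2 / 3) ^ i * b n"
        using Suc by simp
      finally show ?case by simp
    qed simp
    have "(\<Sum>i = 8..Suc n. b (Suc n - i)) \<le> (\<Sum>i = 8..Suc n. (2 / 3) ^ (i - 1) * b n)"
    proof (rule sum_mono)
      fix i
      assume "i \<in> {8..Suc n}"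
      then show "b (Suc n - i) \<le> (2 / 3) ^ (i - 1) * b n"
        using decay[of "i - 1"] by (cases i) auto
    qed
    also have "\<dots> = (\<Sum>i = 8..Suc n. (2 / 3) ^ (i - 1)) * b n"
      by (rule sum_distrib_right[symmetric])
    also have "\<dots> \<le> 1 / 2 * b n"
      using geometric pos by (intro mult_right_mono) auto
    finally show ?case
      using rec[of n] pos by simp
  qed
  show ?thesis
  proof (induction n)
    case (Suc n)
    then show ?case
      using step[of n] by simp
  qed (use init in simp)
qed

section \<open>The grading of the free algebra\<close>

lemma poly_mapping_add_induct [case_names zero single add]:
  fixes a :: "'a \<Rightarrow>\<^sub>0 'b::comm_monoid_add"
  assumes "P 0" and "\<And>w c. P (Poly_Mapping.single w c)" and "\<And>a b. P a \<Longrightarrow> P b \<Longrightarrow> P (a + b)"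
  shows "P a"
proof (induction a rule: Poly_Mapping.update_induct)
  case (update f w c)
  have "Poly_Mapping.update w c f = f + Poly_Mapping.single w c"
    using update.hyps
    by (intro poly_mapping_eqI)
      (auto simp: lookup_update lookup_add lookup_single in_keys_iff when_def)
  then show ?case
    using update assms by simp
qed (fact assms)

text \<open>
  Scalar multiples need no case of their own because every element of the prime field is a sum of ones.
\<close>

lemma free_algebra_induct [case_names zero one add gen]:
  fixes a :: "('d, 'p::prime_card) free_algebra"
  assumes zero: "P 0" and one: "P 1"
    and add: "\<And>a b. P a \<Longrightarrow> P b \<Longrightarrow> P (a + b)"
    and gen: "\<And>j a. P a \<Longrightarrow> P (gen j * a)"
  shows "P a"
proof (induction a rule: poly_mapping_add_induct)
  case (single w c)
  have monomial: "P (Poly_Mapping.single (Monomial ws) 1)" for ws :: "'d list"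
  proof (induction ws)
    case Nil
    then show ?case
      using one by (simp flip: zero_monomial_def)
  next
    case (Cons j ws)
    then show ?case
      using gen[OF Cons.IH, of j] by (simp add: gen_def mult_single plus_monomial_def)
  qed
  obtain k where "c = of_nat k"
    using surj_of_nat_mod_ring by blast
  moreover have "P (Poly_Mapping.single w (of_nat k))"
  proof (induction k)
    case (Suc k)
    then show ?case
      using add[OF monomial[of "letters w"] Suc.IH] by (simp add: single_add)
  qed (use zero in simp)
  ultimately show ?case by simp
qed (use zero add in auto)

definition homogeneous :: "nat \<Rightarrow> ('d, 'p::prime_card) free_algebra \<Rightarrow> bool"
  where "homogeneous n a \<longleftrightarrow> (\<forall>w. Poly_Mapping.lookup a w \<noteq> 0 \<longrightarrow> mdegree w = n)"

definition order_at_least :: "nat \<Rightarrow> ('d, 'p::prime_card) free_algebra \<Rightarrow> bool"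
  where "order_at_least n a \<longleftrightarrow> (\<forall>w. Poly_Mapping.lookup a w \<noteq> 0 \<longrightarrow> n \<le> mdegree w)"

lemma mdegree_simps [simp]:
  "mdegree 0 = 0" "mdegree (u + v) = mdegree u + mdegree v" "mdegree (Monomial ws) = length ws"
  by (simp_all add: mdegree_def zero_monomial_def plus_monomial_def)

lemma mdegree_eq_0_iff [simp]: "mdegree w = 0 \<longleftrightarrow> w = 0"
  by (cases w) (simp add: mdegree_def zero_monomial_def)

lemma homogeneous_0 [simp]: "homogeneous n 0"
  by (simp add: homogeneous_def)

lemma homogeneous_add [intro]: "homogeneous n a \<Longrightarrow> homogeneous n b \<Longrightarrow> homogeneous n (a + b)"
  unfolding homogeneous_def lookup_add by (metis add.right_neutral)

lemma homogeneous_uminus [intro]: "homogeneous n a \<Longrightarrow> homogeneous n (- a)"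
  by (simp add: homogeneous_def)

lemma homogeneous_diff [intro]: "homogeneous n a \<Longrightarrow> homogeneous n b \<Longrightarrow> homogeneous n (a - b)"
  using homogeneous_add[of n a "- b"] homogeneous_uminus[of n b] by simp

lemma homogeneous_sum [intro]: "(\<And>i. i \<in> A \<Longrightarrow> homogeneous n (f i)) \<Longrightarrow> homogeneous n (sum f A)"
  by (induction A rule: infinite_finite_induct) auto

lemma homogeneous_mult [intro]:
  assumes "homogeneous m a" "homogeneous n b"
  shows "homogeneous (m + n) (a * b)"
  using assms keys_mult[of a b] unfolding homogeneous_def in_keys_iff[symmetric] by fastforce

lemma homogeneous_gen [simp]: "homogeneous (Suc 0) (gen j)"
  by (simp add: homogeneous_def gen_def lookup_single when_def)

lemma order_at_least_0 [simp]: "order_at_least n 0" and order_at_least_any [simp]: "order_at_least 0 a"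
  by (simp_all add: order_at_least_def)

lemma order_at_least_add [intro]: "order_at_least n a \<Longrightarrow> order_at_least n b \<Longrightarrow> order_at_least n (a + b)"
  unfolding order_at_least_def lookup_add by (metis add.right_neutral)

lemma order_at_least_uminus [intro]: "order_at_least n a \<Longrightarrow> order_at_least n (- a)"
  by (simp add: order_at_least_def)

lemma order_at_least_diff [intro]: "order_at_least n a \<Longrightarrow> order_at_least n b \<Longrightarrow> order_at_least n (a - b)"
  using order_at_least_add[of n a "- b"] order_at_least_uminus[of n b] by simp

lemma order_at_least_sum [intro]:
  "(\<And>i. i \<in> A \<Longrightarrow> order_at_least n (f i)) \<Longrightarrow> order_at_least n (sum f A)"
  by (induction A rule: infinite_finite_induct) auto

lemma order_at_least_mult [intro]:
  assumes "order_at_least m a" "order_at_least n b"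
  shows "order_at_least (m + n) (a * b)"
  using assms keys_mult[of a b] unfolding order_at_least_def in_keys_iff[symmetric]
  by (fastforce intro: add_mono)

lemma order_at_least_mono: "order_at_least n a \<Longrightarrow> m \<le> n \<Longrightarrow> order_at_least m a"
  by (force simp: order_at_least_def)

lemma homogeneous_order_at_least: "homogeneous n a \<Longrightarrow> order_at_least n a"
  by (simp add: order_at_least_def homogeneous_def)

lemma order_at_least_1_iff: "order_at_least (Suc 0) a \<longleftrightarrow> constant_term a = 0"
  by (auto simp: order_at_least_def constant_term_def Suc_le_eq zero_less_iff_neq_zero)

lemma lookup_homogeneous_part:
  "Poly_Mapping.lookup (homogeneous_part n a) w = (if mdegree w = n then Poly_Mapping.lookup a w else 0)"
  unfolding homogeneous_part_def lookup_sum lookup_single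
  by (auto simp: when_def sum.delta' in_keys_iff sum.If_cases intro!: sum.neutral)

lemma homogeneous_homogeneous_part [simp]: "homogeneous n (homogeneous_part n a)"
  by (simp add: homogeneous_def lookup_homogeneous_part)

lemma homogeneous_part_0 [simp]: "homogeneous_part n 0 = 0"
  by (rule poly_mapping_eqI) (simp add: lookup_homogeneous_part)

lemma homogeneous_part_add: "homogeneous_part n (a + b) = homogeneous_part n a + homogeneous_part n b"
  by (rule poly_mapping_eqI) (simp add: lookup_homogeneous_part lookup_add)

lemma homogeneous_part_single:
  "homogeneous_part n (Poly_Mapping.single w c) = (if mdegree w = n then Poly_Mapping.single w c else 0)"
  by (rule poly_mapping_eqI) (auto simp: lookup_homogeneous_part lookup_single when_def)

lemma homogeneous_part_homogeneous:
  "homogeneous m a \<Longrightarrow> homogeneous_part n a = (if m = n then a else 0)"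
  by (rule poly_mapping_eqI) (auto simp: lookup_homogeneous_part homogeneous_def)

lemma homogeneous_degree_unique: "homogeneous m a \<Longrightarrow> homogeneous n a \<Longrightarrow> a \<noteq> 0 \<Longrightarrow> m = n"
  using homogeneous_part_homogeneous[of m a n] homogeneous_part_homogeneous[of n a n]
  by (cases "m = n") simp_all

lemma homogeneous_part_order_at_least: "order_at_least m a \<Longrightarrow> n < m \<Longrightarrow> homogeneous_part n a = 0"
  by (rule poly_mapping_eqI) (force simp: lookup_homogeneous_part order_at_least_def)

lemma sum_homogeneous_parts: "\<exists>N. a = (\<Sum>n<N. homogeneous_part n a)"
proof
  let ?N = "Suc (Max (mdegree ` Poly_Mapping.keys a))"
  show "a = (\<Sum>n<?N. homogeneous_part n a)"
  proof (rule poly_mapping_eqI)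
    fix w
    have "mdegree w < ?N" if "Poly_Mapping.lookup a w \<noteq> 0"
      using that by (intro le_imp_less_Suc Max_ge) (auto simp: in_keys_iff)
    then show "Poly_Mapping.lookup a w = Poly_Mapping.lookup (\<Sum>n<?N. homogeneous_part n a) w"
      by (cases "Poly_Mapping.lookup a w = 0") (simp_all add: lookup_sum lookup_homogeneous_part del: sum.lessThan_Suc)
  qed
qed

lemma homogeneous_part_gen_mult_Suc [simp]:
  "homogeneous_part (Suc n) (gen j * a) = gen j * homogeneous_part n a"
  by (induction a rule: poly_mapping_add_induct)
    (simp_all add: homogeneous_part_add distrib_left gen_def mult_single homogeneous_part_single)

lemma homogeneous_part_mult_gen_Suc [simp]:
  "homogeneous_part (Suc n) (a * gen j) = homogeneous_part n a * gen j"
  by (induction a rule: poly_mapping_add_induct)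
    (simp_all add: homogeneous_part_add distrib_right gen_def mult_single homogeneous_part_single)

lemma order_at_least_gen: "order_at_least (Suc 0) (gen j)"
  by (rule homogeneous_order_at_least) simp

lemma homogeneous_part_gen_mult_0 [simp]:
  "homogeneous_part 0 (gen j * a) = 0" "homogeneous_part 0 (a * gen j) = 0"
  by (rule homogeneous_part_order_at_least[where m = 1];
      use order_at_least_mult[OF order_at_least_gen, of 0 a j]
        order_at_least_mult[of 0 a, OF _ order_at_least_gen[of j]] in simp)+

lemma finite_bounded_degree:
  "finite {a :: ('d::finite, 'p::prime_card) free_algebra. \<forall>w. Poly_Mapping.lookup a w \<noteq> 0 \<longrightarrow> mdegree w \<le> n}"
proof -
  have "finite (Monomial ` {ws :: 'd list. set ws \<subseteq> UNIV \<and> length ws \<le> n})"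
    by (intro finite_imageI finite_lists_length_le) simp
  also have "Monomial ` {ws :: 'd list. set ws \<subseteq> UNIV \<and> length ws \<le> n} = {w. mdegree w \<le> n}"
  proof (intro equalityI subsetI)
    fix w :: "'d monomial"
    assume "w \<in> {w. mdegree w \<le> n}"
    then show "w \<in> Monomial ` {ws. set ws \<subseteq> UNIV \<and> length ws \<le> n}"
      by (cases w) simp
  qed auto
  finally have "finite {f :: 'd monomial \<Rightarrow> 'p mod_ring. \<forall>w. (w \<in> {w. mdegree w \<le> n} \<longrightarrow> f w \<in> UNIV)
      \<and> (w \<notin> {w. mdegree w \<le> n} \<longrightarrow> f w = 0)}"
    by (rule finite_set_of_finite_funs) simp
  then have "finite (Poly_Mapping.lookup ` {a :: ('d, 'p) free_algebra.
      \<forall>w. Poly_Mapping.lookup a w \<noteq> 0 \<longrightarrow> mdegree w \<le> n})"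
    by (rule finite_subset[rotated]) auto
  then show ?thesis
    by (rule finite_imageD) (auto intro!: inj_onI poly_mapping_eqI)
qed

lemma finite_homogeneous: "finite {a :: ('d::finite, 'p::prime_card) free_algebra. homogeneous n a}"
  by (rule finite_subset[OF _ finite_bounded_degree[of n]]) (auto simp: homogeneous_def)

lemma inj_Cons_monomial: "inj ((+) (Monomial [j]))"
  by (rule injI) (simp add: plus_monomial_def monomial.expand)

text \<open>
  The free algebra is the direct sum of the constants and of the right ideals \<open>gen j * A\<close>, each of
  which is a free right module on one generator. This is the coordinate map of the summand of \<open>j\<close>.
\<close>

definition left_quotient :: "'d \<Rightarrow> ('d, 'p::prime_card) free_algebra \<Rightarrow> ('d, 'p) free_algebra"
  where "left_quotient j = Poly_Mapping.map_key ((+) (Monomial [j]))"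

lemma lookup_left_quotient:
  "Poly_Mapping.lookup (left_quotient j a) w = Poly_Mapping.lookup a (Monomial [j] + w)"
  by (simp add: left_quotient_def map_key.rep_eq inj_Cons_monomial)

lemma left_quotient_0 [simp]: "left_quotient j 0 = 0"
  by (rule poly_mapping_eqI) (simp add: lookup_left_quotient)

lemma left_quotient_add: "left_quotient j (a + b) = left_quotient j a + left_quotient j b"
  by (rule poly_mapping_eqI) (simp add: lookup_left_quotient lookup_add)

lemma left_quotient_sum: "left_quotient j (sum f A) = (\<Sum>i\<in>A. left_quotient j (f i))"
  by (rule poly_mapping_eqI) (simp add: lookup_left_quotient lookup_sum)

lemma left_quotient_gen_mult: "left_quotient j (gen k * a) = (if j = k then a else 0)"
proof (induction a rule: poly_mapping_add_induct)
  case (single w c)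
  have "Monomial [k] + w = Monomial [j] + v \<longleftrightarrow> k = j \<and> w = v" for v :: "'a monomial"
    by (cases w; cases v) (simp add: plus_monomial_def)
  then show ?case
    by (intro poly_mapping_eqI) (auto simp: lookup_left_quotient gen_def mult_single lookup_single when_def)
qed (simp_all add: left_quotient_add distrib_left)

lemma left_quotient_order:
  assumes "order_at_least (Suc n) a"
  shows "order_at_least n (left_quotient j a)"
  unfolding order_at_least_def lookup_left_quotient
proof (intro allI impI)
  fix w
  assume "Poly_Mapping.lookup a (Monomial [j] + w) \<noteq> 0"
  then have "Suc n \<le> mdegree (Monomial [j] + w)"
    using assms unfolding order_at_least_def by blast
  then show "n \<le> mdegree w" by simp
qed

lemma left_expansion:
  fixes a :: "('d::finite, 'p::prime_card) free_algebra"
  shows "a = Poly_Mapping.single 0 (constant_term a) + (\<Sum>j\<in>UNIV. gen j * left_quotient j a)"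
proof (induction a rule: free_algebra_induct)
  case zero
  show ?case by (simp add: constant_term_def)
next
  case one
  have "left_quotient j (1 :: ('d, 'p) free_algebra) = 0" for j
    by (rule poly_mapping_eqI)
      (simp add: lookup_left_quotient lookup_one when_def zero_monomial_def plus_monomial_def)
  then show ?case by (simp add: constant_term_def)
next
  case (add a b)
  have "Poly_Mapping.single 0 (constant_term (a + b)) + (\<Sum>j\<in>UNIV. gen j * left_quotient j (a + b))
      = (Poly_Mapping.single 0 (constant_term a) + (\<Sum>j\<in>UNIV. gen j * left_quotient j a))
        + (Poly_Mapping.single 0 (constant_term b) + (\<Sum>j\<in>UNIV. gen j * left_quotient j b))"
    by (simp add: left_quotient_add distrib_left sum.distrib constant_term_def lookup_add single_add)
  then show ?case
    using add by simp
next
  case (gen k a)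
  have "constant_term (gen k * a) = 0"
    unfolding order_at_least_1_iff[symmetric]
    using order_at_least_mult[OF homogeneous_order_at_least[OF homogeneous_gen] order_at_least_any, of k a]
    by simp
  moreover have "(\<Sum>j\<in>UNIV. gen j * left_quotient j (gen k * a)) = (\<Sum>j\<in>UNIV. if j = k then gen k * a else 0)"
    by (rule sum.cong) (simp_all add: left_quotient_gen_mult)
  ultimately show ?case by simp
qed

lemma left_expansion_no_constant:
  fixes a :: "('d::finite, 'p::prime_card) free_algebra"
  assumes "order_at_least (Suc 0) a"
  shows "a = (\<Sum>j\<in>UNIV. gen j * left_quotient j a)"
proof -
  have "constant_term a = 0"
    using assms by (simp add: order_at_least_1_iff)
  then show ?thesis
    using left_expansion[of a] by (metis add_0 single_zero)
qed

lemma left_expansion_unique: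
  fixes f g :: "'d::finite \<Rightarrow> ('d, 'p::prime_card) free_algebra"
  assumes "(\<Sum>j\<in>UNIV. gen j * f j) = (\<Sum>j\<in>UNIV. gen j * g j)"
  shows "f = g"
proof
  fix k
  have "left_quotient k (\<Sum>j\<in>UNIV. gen j * h j) = h k" for h :: "'d \<Rightarrow> ('d, 'p) free_algebra"
    by (simp add: left_quotient_sum left_quotient_gen_mult)
  then show "f k = g k"
    using assms by metis
qed

section \<open>Ideals of the free algebra\<close>

lemma free_algebra_ring_simps [simp]:
  "a \<oplus>\<^bsub>free_algebra_ring\<^esub> b = a + (b :: ('d, 'p::prime_card) free_algebra)"
  "a \<otimes>\<^bsub>free_algebra_ring\<^esub> b = a * (b :: ('d, 'p) free_algebra)"
  "\<zero>\<^bsub>free_algebra_ring\<^esub> = (0 :: ('d, 'p) free_algebra)"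
  "\<one>\<^bsub>free_algebra_ring\<^esub> = (1 :: ('d, 'p) free_algebra)"
  by (simp_all add: ring_of_type_algebra_def)

lemma a_inv_free_algebra: "\<ominus>\<^bsub>free_algebra_ring\<^esub> a = - (a :: ('d, 'p::prime_card) free_algebra)"
  by (rule abelian_group.minus_equality[OF ring.is_abelian_group[OF ring_free_algebra]]) simp_all

text \<open>
  Closure under multiplication by arbitrary elements follows from the case of generators by induction
  over the free algebra; negatives are multiples by \<open>- 1\<close>.
\<close>

lemma ideal_free_algebraI:
  fixes K :: "('d, 'p::prime_card) free_algebra set"
  assumes zero: "0 \<in> K"
    and add: "\<And>a b. a \<in> K \<Longrightarrow> b \<in> K \<Longrightarrow> a + b \<in> K"
    and gen_left: "\<And>j a. a \<in> K \<Longrightarrow> gen j * a \<in> K"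
    and gen_right: "\<And>j a. a \<in> K \<Longrightarrow> a * gen j \<in> K"
  shows "ideal K free_algebra_ring"
proof -
  have left: "b * a \<in> K" if "a \<in> K" for a b
    by (induction b rule: free_algebra_induct)
      (use that zero add gen_left in \<open>auto simp: distrib_right mult.assoc\<close>)
  have right: "a * b \<in> K" if "a \<in> K" for a b
    using that
  proof (induction b arbitrary: a rule: free_algebra_induct)
    case (gen j b)
    then show ?case
      using gen.IH[OF gen_right[of a j]] by (simp add: mult.assoc)
  qed (use zero add in \<open>auto simp: distrib_left\<close>)
  have uminus: "- a \<in> K" if "a \<in> K" for a
    using left[OF that, of "- 1"] by simp
  have "inv\<^bsub>add_monoid free_algebra_ring\<^esub> a = - a" for a :: "('d, 'p) free_algebra"
    using a_inv_free_algebra[of a] by (simp only: a_inv_def)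
  then have inv: "inv\<^bsub>add_monoid free_algebra_ring\<^esub> a \<in> K" if "a \<in> K" for a
    using uminus[OF that] by metis
  have "subgroup K (add_monoid free_algebra_ring)"
    by (rule subgroup.intro) (use inv zero add in simp_all)
  then show ?thesis
    by (rule idealI[OF ring_free_algebra]) (use left right in simp_all)
qed

lemma
  fixes K :: "('d, 'p::prime_card) free_algebra set"
  assumes "ideal K free_algebra_ring"
  shows ideal_zero: "0 \<in> K"
    and ideal_add: "\<And>a b. a \<in> K \<Longrightarrow> b \<in> K \<Longrightarrow> a + b \<in> K"
    and ideal_mult_left: "\<And>a b. a \<in> K \<Longrightarrow> b * a \<in> K"
    and ideal_mult_right: "\<And>a b. a \<in> K \<Longrightarrow> a * b \<in> K"
  using additive_subgroup.zero_closed[OF ideal.axioms(1)[OF assms]]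
    additive_subgroup.a_closed[OF ideal.axioms(1)[OF assms]]
    ideal.I_l_closed[OF assms] ideal.I_r_closed[OF assms]
  by simp_all

lemma ideal_uminus:
  fixes a :: "('d, 'p::prime_card) free_algebra"
  assumes "ideal K free_algebra_ring" "a \<in> K"
  shows "- a \<in> K"
  using ideal_mult_left[OF assms, of "- 1"] by simp

lemma ideal_diff:
  fixes a :: "('d, 'p::prime_card) free_algebra"
  assumes "ideal K free_algebra_ring" "a \<in> K" "b \<in> K"
  shows "a - b \<in> K"
  using ideal_add[OF assms(1,2) ideal_uminus[OF assms(1,3)]] by simp

lemma ideal_sum:
  fixes f :: "'i \<Rightarrow> ('d, 'p::prime_card) free_algebra"
  assumes "ideal K free_algebra_ring" "\<And>i. i \<in> A \<Longrightarrow> f i \<in> K"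
  shows "sum f A \<in> K"
  using assms(2) by (induction A rule: infinite_finite_induct)
    (auto intro: ideal_zero[OF assms(1)] ideal_add[OF assms(1)])

lemma ideal_order_at_least:
  "ideal {a :: ('d, 'p::prime_card) free_algebra. order_at_least n a} free_algebra_ring"
  by (rule ideal_free_algebraI)
    (auto intro: order_at_least_mult[of 0, simplified] order_at_least_mult[of _ _ 0, simplified])

section \<open>Hilbert functions of sparsely presented graded algebras\<close>

text \<open>
  A choice of related elements is an injection; in this form it need not be written down as a function.
\<close>

lemma card_le_if_separating_relation:
  assumes "finite B"
    and total: "\<And>a. a \<in> A \<Longrightarrow> \<exists>b\<in>B. R a b"
    and separating: "\<And>a a' b. a \<in> A \<Longrightarrow> a' \<in> A \<Longrightarrow> R a b \<Longrightarrow> R a' b \<Longrightarrow> a = a'"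
  shows "card A \<le> card B"
proof -
  have "\<forall>a\<in>A. \<exists>b. b \<in> B \<and> R a b"
    using total by blast
  then obtain f where f: "\<forall>a\<in>A. f a \<in> B \<and> R a (f a)"
    by (rule bchoice[THEN exE])
  have "inj_on f A"
    using f separating by (metis inj_onI)
  then show ?thesis
    by (rule card_inj_on_le) (use f \<open>finite B\<close> in auto)
qed

text \<open>
  A two-sided ideal generated by homogeneous relators, at most one in each degree and none in degrees
  below 8; \<open>rel i = 0\<close> stands for the absence of a relator of degree \<open>i\<close>, and \<open>minimal\<close> says that the relators
  generate \<open>J\<close>.
\<close>

locale sparse_graded_ideal =
  fixes J :: "('d::finite, 'p::prime_card) free_algebra set"
    and rel :: "nat \<Rightarrow> ('d, 'p) free_algebra"
  assumes ideal: "ideal J free_algebra_ring"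
    and rel_in: "rel i \<in> J"
    and homogeneous_rel: "homogeneous i (rel i)"
    and rel_low: "i < 8 \<Longrightarrow> rel i = 0"
    and minimal: "ideal K free_algebra_ring \<Longrightarrow> (\<And>i. rel i \<in> K) \<Longrightarrow> J \<subseteq> K"
begin

lemma order_J: 
  assumes "a \<in> J"
  shows "order_at_least 8 a"
proof -
  have "order_at_least 8 (rel i)" for i
    by (cases "i < 8") (auto simp: rel_low intro: order_at_least_mono homogeneous_order_at_least[OF homogeneous_rel])
  then have "J \<subseteq> {a. order_at_least 8 a}"
    by (intro minimal ideal_order_at_least) simp
  with assms show ?thesis by blast
qed

text \<open>
  A two-sided multiple \<open>u * rel i * v\<close> with monomials \<open>u\<close> and \<open>v\<close> belongs to the first sum if \<open>u\<close> begins with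
  a generator and to the second if \<open>u\<close> is empty. Since \<open>gen j * g\<close> has no constant term, the condition
  \<open>homogeneous n (gen j * g j)\<close> makes all \<open>g j\<close> vanish for \<open>n = 0\<close>, without a case distinction.
\<close>

definition decomposable :: "nat \<Rightarrow> ('d, 'p) free_algebra set"
  where "decomposable n = {a. \<exists>g b. (\<forall>j. g j \<in> J \<and> homogeneous n (gen j * g j))
    \<and> (\<forall>i\<le>n. homogeneous (n - i) (b i))
    \<and> a = (\<Sum>j\<in>UNIV. gen j * g j) + (\<Sum>i\<le>n. rel i * b i)}"

lemma decomposableI:
  assumes "\<And>j. g j \<in> J" "\<And>j. homogeneous n (gen j * g j)" "\<And>i. i \<le> n \<Longrightarrow> homogeneous (n - i) (b i)"
    and "a = (\<Sum>j\<in>UNIV. gen j * g j) + (\<Sum>i\<le>n. rel i * b i)"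
  shows "a \<in> decomposable n"
  using assms unfolding decomposable_def by blast

lemma decomposableE:
  assumes "a \<in> decomposable n"
  obtains g b where "\<And>j. g j \<in> J" "\<And>j. homogeneous n (gen j * g j)"
    "\<And>i. i \<le> n \<Longrightarrow> homogeneous (n - i) (b i)"
    "a = (\<Sum>j\<in>UNIV. gen j * g j) + (\<Sum>i\<le>n. rel i * b i)"
  using assms unfolding decomposable_def by blast

lemma decomposable_homogeneous:
  assumes "a \<in> decomposable n"
  shows "homogeneous n a"
  using assms
proof (rule decomposableE)
  fix g b
  assume g: "\<And>j. homogeneous n (gen j * g j)" and b: "\<And>i. i \<le> n \<Longrightarrow> homogeneous (n - i) (b i)"
    and a: "a = (\<Sum>j\<in>UNIV. gen j * g j) + (\<Sum>i\<le>n. rel i * b i)"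
  have "homogeneous n (rel i * b i)" if "i \<le> n" for i
    using homogeneous_mult[OF homogeneous_rel[of i] b[OF that]] that by simp
  then show ?thesis
    unfolding a using g by (intro homogeneous_add homogeneous_sum) simp_all
qed

lemma decomposable_in_J: "a \<in> decomposable n \<Longrightarrow> a \<in> J"
  by (erule decomposableE)
    (simp add: ideal_add[OF ideal] ideal_sum[OF ideal] ideal_mult_left[OF ideal]
      ideal_mult_right[OF ideal] rel_in)

lemma decomposable_0: "0 \<in> decomposable n"
  by (rule decomposableI[of "\<lambda>_. 0" _ "\<lambda>_. 0"]) (simp_all add: ideal_zero[OF ideal])

lemma decomposable_add:
  assumes "a \<in> decomposable n" "a' \<in> decomposable n"
  shows "a + a' \<in> decomposable n"
  using assms(1)
proof (rule decomposableE)
  fix g b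
  assume g: "\<And>j. g j \<in> J" "\<And>j. homogeneous n (gen j * g j)"
    and b: "\<And>i. i \<le> n \<Longrightarrow> homogeneous (n - i) (b i)"
    and a: "a = (\<Sum>j\<in>UNIV. gen j * g j) + (\<Sum>i\<le>n. rel i * b i)"
  show ?thesis
    using assms(2)
  proof (rule decomposableE)
    fix g' b'
    assume g': "\<And>j. g' j \<in> J" "\<And>j. homogeneous n (gen j * g' j)"
      and b': "\<And>i. i \<le> n \<Longrightarrow> homogeneous (n - i) (b' i)"
      and a': "a' = (\<Sum>j\<in>UNIV. gen j * g' j) + (\<Sum>i\<le>n. rel i * b' i)"
    show ?thesis
    proof (rule decomposableI)
      show "g j + g' j \<in> J" for j
        using g g' by (intro ideal_add[OF ideal])
      show "homogeneous n (gen j * (g j + g' j))" for j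
        unfolding distrib_left using g g' by blast
      show "homogeneous (n - i) (b i + b' i)" if "i \<le> n" for i
        using that b b' by blast
      show "a + a' = (\<Sum>j\<in>UNIV. gen j * (g j + g' j)) + (\<Sum>i\<le>n. rel i * (b i + b' i))"
        unfolding a a' by (simp add: distrib_left sum.distrib)
    qed
  qed
qed

lemma decomposable_gen_left:
  assumes "a \<in> decomposable n"
  shows "gen k * a \<in> decomposable (Suc n)"
proof (rule decomposableI)
  let ?g = "\<lambda>j. if j = k then a else 0"
  show "?g j \<in> J" for j
    using decomposable_in_J[OF assms] ideal_zero[OF ideal] by simp
  show "homogeneous (Suc n) (gen j * ?g j)" for j
    using homogeneous_mult[OF homogeneous_gen decomposable_homogeneous[OF assms]] by simp
  have "(\<Sum>j\<in>UNIV. gen j * ?g j) = (\<Sum>j\<in>UNIV. if j = k then gen k * a else 0)"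
    by (rule sum.cong) simp_all
  then show "gen k * a = (\<Sum>j\<in>UNIV. gen j * ?g j) + (\<Sum>i\<le>Suc n. rel i * 0)"
    by simp
qed simp

lemma decomposable_gen_right:
  assumes "a \<in> decomposable n"
  shows "a * gen k \<in> decomposable (Suc n)"
  using assms
proof (rule decomposableE)
  fix g b
  assume g: "\<And>j. g j \<in> J" "\<And>j. homogeneous n (gen j * g j)"
    and b: "\<And>i. i \<le> n \<Longrightarrow> homogeneous (n - i) (b i)"
    and a: "a = (\<Sum>j\<in>UNIV. gen j * g j) + (\<Sum>i\<le>n. rel i * b i)"
  let ?b = "\<lambda>i. if i \<le> n then b i * gen k else 0"
  show ?thesis
  proof (rule decomposableI)
    show "g j * gen k \<in> J" for j
      by (rule ideal_mult_right[OF ideal g(1)])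
    show "homogeneous (Suc n) (gen j * (g j * gen k))" for j
      using homogeneous_mult[OF g(2)[of j] homogeneous_gen[of k]] by (simp add: mult.assoc)
    show "homogeneous (Suc n - i) (?b i)" if "i \<le> Suc n" for i
      using homogeneous_mult[OF b homogeneous_gen, of i k] that by (simp add: Suc_diff_le)
    show "a * gen k = (\<Sum>j\<in>UNIV. gen j * (g j * gen k)) + (\<Sum>i\<le>Suc n. rel i * ?b i)"
      unfolding a by (simp add: distrib_right sum_distrib_right mult.assoc)
  qed
qed

lemma rel_decomposable: "rel n \<in> decomposable n"
proof (rule decomposableI)
  let ?b = "\<lambda>i. if i = n then 1 else 0"
  show "homogeneous (n - i) (?b i)" if "i \<le> n" for i
    by (simp add: homogeneous_def lookup_one when_def)
  have "(\<Sum>i\<le>n. rel i * ?b i) = (\<Sum>i\<le>n. if i = n then rel n else 0)"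
    by (rule sum.cong) simp_all
  then show "rel n = (\<Sum>j\<in>UNIV. gen j * 0) + (\<Sum>i\<le>n. rel i * ?b i)"
    by simp
qed (simp_all add: ideal_zero[OF ideal])

text \<open>
  The elements all of whose homogeneous parts are decomposable form an ideal that contains the
  relators, hence all of \<open>J\<close>. In particular \<open>J\<close> is a homogeneous ideal.
\<close>

lemma homogeneous_part_decomposable:
  assumes "a \<in> J"
  shows "homogeneous_part n a \<in> decomposable n"
proof -
  let ?K = "{a. \<forall>n. homogeneous_part n a \<in> decomposable n}"
  have "J \<subseteq> ?K"
  proof (rule minimal)
    show "ideal ?K free_algebra_ring"
    proof (rule ideal_free_algebraI)
      fix a j
      assume a: "a \<in> ?K"
      have "homogeneous_part n (gen j * a) \<in> decomposable n"
        "homogeneous_part n (a * gen j) \<in> decomposable n" for n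
        using a by (cases n; simp add: decomposable_0 decomposable_gen_left decomposable_gen_right)+
      then show "gen j * a \<in> ?K" "a * gen j \<in> ?K"
        by simp_all
    qed (simp_all add: decomposable_0 homogeneous_part_add decomposable_add)
    show "rel i \<in> ?K" for i
      by (simp add: homogeneous_part_homogeneous[OF homogeneous_rel] rel_decomposable decomposable_0)
  qed
  then show ?thesis
    using assms by blast
qed

lemma homogeneous_part_in_J: "a \<in> J \<Longrightarrow> homogeneous_part n a \<in> J"
  by (rule decomposable_in_J[OF homogeneous_part_decomposable])

text \<open>
  A representative of the coset of \<open>a\<close> modulo \<open>J\<close> within degree \<open>n\<close>. The choice depends on the coset only,
  so \<open>card (reps n)\<close> counts cosets: its logarithm to the base \<open>p\<close> is the dimension of the component of
  degree \<open>n\<close> of the quotient by \<open>J\<close>.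
\<close>

definition rep :: "nat \<Rightarrow> ('d, 'p) free_algebra \<Rightarrow> ('d, 'p) free_algebra"
  where "rep n a = (SOME b. homogeneous n b \<and> a - b \<in> J)"

definition reps :: "nat \<Rightarrow> ('d, 'p) free_algebra set"
  where "reps n = rep n ` {a. homogeneous n a}"

lemma
  assumes "homogeneous n a"
  shows homogeneous_rep: "homogeneous n (rep n a)" and rep_cong: "a - rep n a \<in> J"
proof -
  have "homogeneous n (rep n a) \<and> a - rep n a \<in> J"
    unfolding rep_def by (rule someI[of _ a]) (use assms ideal_zero[OF ideal] in simp)
  then show "homogeneous n (rep n a)" "a - rep n a \<in> J"
    by simp_all
qed

lemma finite_reps: "finite (reps n)"
  unfolding reps_def by (rule finite_imageI[OF finite_homogeneous])

lemma rep_eqI: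
  assumes "a - a' \<in> J"
  shows "rep n a = rep n a'"
proof -
  have "a - b \<in> J \<longleftrightarrow> a' - b \<in> J" for b
    using ideal_add[OF ideal assms, of "a' - b"] ideal_diff[OF ideal _ assms, of "a - b"] by auto
  then show ?thesis
    by (simp add: rep_def)
qed

lemma reps_homogeneous: "c \<in> reps n \<Longrightarrow> homogeneous n c"
  by (auto simp: reps_def intro: homogeneous_rep)

lemma reps_eqI:
  assumes "c \<in> reps n" "c' \<in> reps n" "c - c' \<in> J"
  shows "c = c'"
proof -
  have rep_idem: "rep n b = b" if "b \<in> reps n" for b
    using that unfolding reps_def
  proof (rule imageE)
    fix a
    assume b: "b = rep n a" and "a \<in> {a. homogeneous n a}"
    then have "a - b \<in> J"
      by (simp add: rep_cong)
    then have "rep n b = rep n a"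
      by (rule rep_eqI[symmetric])
    also have "\<dots> = b"
      by (rule b[symmetric])
    finally show "rep n b = b" .
  qed
  have "c = rep n c"
    by (rule rep_idem[OF assms(1), symmetric])
  also have "\<dots> = rep n c'"
    by (rule rep_eqI[OF assms(3)])
  also have "\<dots> = c'"
    by (rule rep_idem[OF assms(2)])
  finally show ?thesis .
qed

text \<open>
  Subtracting its representative makes \<open>a\<close> an element of \<open>J\<close> and hence decomposable. A coefficient \<open>b i\<close> of
  \<open>rel i\<close> may then be replaced by its representative, because the error \<open>rel i * h\<close> with \<open>h \<in> J\<close> is again
  a sum of left multiples \<open>gen j * g\<close> with \<open>g \<in> J\<close>: the relator \<open>rel i\<close> has no constant term.
\<close>

lemma decompose_modulo_left_multiples:
  assumes a: "homogeneous n a"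
  shows "\<exists>u c g. u \<in> reps n \<and> c \<in> (\<Pi>\<^sub>E i\<in>{8..n}. reps (n - i)) \<and> (\<forall>j. g j \<in> J)
    \<and> a = u + (\<Sum>i\<in>{8..n}. rel i * c i) + (\<Sum>j\<in>UNIV. gen j * g j)"
proof -
  obtain u where u: "u \<in> reps n" "homogeneous n u" "a - u \<in> J"
    using homogeneous_rep[OF a] rep_cong[OF a] a by (intro that[of "rep n a"]) (simp_all add: reps_def)
  then have "a - u \<in> decomposable n"
    using homogeneous_part_decomposable[OF u(3), of n] homogeneous_diff[OF a u(2)]
    by (simp add: homogeneous_part_homogeneous)
  then obtain g b where g: "\<And>j. g j \<in> J"
    and b: "\<And>i. i \<le> n \<Longrightarrow> homogeneous (n - i) (b i)"
    and a_eq: "a - u = (\<Sum>j\<in>UNIV. gen j * g j) + (\<Sum>i\<le>n. rel i * b i)"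
    by (rule decomposableE) blast
  define c where "c = (\<lambda>i\<in>{8..n}. rep (n - i) (b i))"
  define h where "h i = b i - rep (n - i) (b i)" for i
  define g' where "g' j = g j + (\<Sum>i\<in>{8..n}. left_quotient j (rel i) * h i)" for j
  have h: "h i \<in> J" if "i \<le> n" for i
    unfolding h_def by (rule rep_cong[OF b[OF that]])
  \<comment> \<open>Only degrees from 8 on carry relators.\<close>
  have "(\<Sum>i\<le>n. rel i * b i) = (\<Sum>i\<in>{8..n}. rel i * b i)"
    by (rule sum.mono_neutral_right) (auto simp: rel_low)
  also have "\<dots> = (\<Sum>i\<in>{8..n}. rel i * c i + rel i * h i)"
    by (rule sum.cong) (simp_all add: c_def h_def flip: distrib_left)
  also have "\<dots> = (\<Sum>i\<in>{8..n}. rel i * c i) + (\<Sum>i\<in>{8..n}. rel i * h i)"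
    by (rule sum.distrib)
  also have "(\<Sum>i\<in>{8..n}. rel i * h i)
      = (\<Sum>i\<in>{8..n}. \<Sum>j\<in>UNIV. gen j * (left_quotient j (rel i) * h i))"
  proof (rule sum.cong[OF refl])
    fix i
    assume "i \<in> {8..n}"
    then have "order_at_least (Suc 0) (rel i)"
      by (auto intro: order_at_least_mono homogeneous_order_at_least[OF homogeneous_rel])
    then have "rel i * h i = (\<Sum>j\<in>UNIV. gen j * left_quotient j (rel i)) * h i"
      by (intro arg_cong[of _ _ "\<lambda>a. a * h i"] left_expansion_no_constant)
    then show "rel i * h i = (\<Sum>j\<in>UNIV. gen j * (left_quotient j (rel i) * h i))"
      by (simp add: sum_distrib_right mult.assoc)
  qed
  also have "\<dots> = (\<Sum>j\<in>UNIV. gen j * (\<Sum>i\<in>{8..n}. left_quotient j (rel i) * h i))"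
    unfolding sum_distrib_left by (rule sum.swap)
  finally have rel_part: "(\<Sum>i\<le>n. rel i * b i) = (\<Sum>i\<in>{8..n}. rel i * c i)
      + (\<Sum>j\<in>UNIV. gen j * (\<Sum>i\<in>{8..n}. left_quotient j (rel i) * h i))" .
  have "a = u + (a - u)"
    by simp
  also have "\<dots> = u + (\<Sum>i\<in>{8..n}. rel i * c i) + (\<Sum>j\<in>UNIV. gen j * g' j)"
    unfolding a_eq rel_part g'_def distrib_left sum.distrib by (simp only: ac_simps)
  finally have a_sum: "a = u + (\<Sum>i\<in>{8..n}. rel i * c i) + (\<Sum>j\<in>UNIV. gen j * g' j)" .
  have g': "g' j \<in> J" for j
    unfolding g'_def using g h
    by (intro ideal_add[OF ideal] ideal_sum[OF ideal] ideal_mult_left[OF ideal]) simp_all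
  have c: "c \<in> (\<Pi>\<^sub>E i\<in>{8..n}. reps (n - i))"
  proof (rule PiE_I)
    fix i
    assume i: "i \<in> {8..n}"
    then have "rep (n - i) (b i) \<in> reps (n - i)"
      unfolding reps_def by (intro imageI CollectI b) simp
    with i show "c i \<in> reps (n - i)"
      by (simp add: c_def)
  next
    show "c i = undefined" if "i \<notin> {8..n}" for i
      unfolding c_def restrict_def using that by (rule if_not_P)
  qed
  show ?thesis
    using u(1) g' c a_sum by (intro exI[of _ u] exI[of _ c] exI[of _ g'] conjI allI)
qed

text \<open>
  The Golod--Shafarevich inequality in multiplicative form. A family \<open>f\<close> of representatives of degree \<open>n\<close>
  yields the element \<open>\<Sum>j. gen j * f j\<close>; the data \<open>(u, c)\<close> of its decomposition determine it modulo the sum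
  of the \<open>gen j * J\<close>, and therefore determine every \<open>f j\<close> modulo \<open>J\<close>.
\<close>

lemma card_reps_Suc:
  "card (reps n) ^ CARD('d) \<le> card (reps (Suc n)) * (\<Prod>i\<in>{8..Suc n}. card (reps (Suc n - i)))"
proof -
  let ?F = "\<Pi>\<^sub>E j\<in>(UNIV :: 'd set). reps n"
  let ?C = "\<Pi>\<^sub>E i\<in>{8..Suc n}. reps (Suc n - i)"
  let ?R = "\<lambda>f (u, c). \<exists>g. (\<forall>j. g j \<in> J)
    \<and> (\<Sum>j\<in>UNIV. gen j * f j) = u + (\<Sum>i\<in>{8..Suc n}. rel i * c i) + (\<Sum>j\<in>UNIV. gen j * g j)"
  have "card ?F \<le> card (reps (Suc n) \<times> ?C)"
  proof (rule card_le_if_separating_relation[where R = ?R])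
    show "finite (reps (Suc n) \<times> ?C)"
      by (intro finite_cartesian_product finite_PiE finite_reps) simp
    fix f
    assume f: "f \<in> ?F"
    then have "homogeneous (Suc n) (\<Sum>j\<in>UNIV. gen j * f j)"
      using homogeneous_mult[OF homogeneous_gen reps_homogeneous]
      by (intro homogeneous_sum) (auto dest: PiE_mem)
    then obtain u c g where "u \<in> reps (Suc n)" "c \<in> ?C" "\<forall>j. g j \<in> J"
      "(\<Sum>j\<in>UNIV. gen j * f j) = u + (\<Sum>i\<in>{8..Suc n}. rel i * c i) + (\<Sum>j\<in>UNIV. gen j * g j)"
      using decompose_modulo_left_multiples by blast
    then show "\<exists>uc\<in>reps (Suc n) \<times> ?C. ?R f uc"
      by (intro bexI[of _ "(u, c)"] SigmaI) (simp_all only: prod.case, blast)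
    fix f' uc
    assume f': "f' \<in> ?F" and R: "?R f uc" "?R f' uc"
    obtain u c where uc: "uc = (u, c)"
      by (cases uc)
    obtain g g' where g: "\<And>j. g j \<in> J" and g': "\<And>j. g' j \<in> J"
      and eq: "(\<Sum>j\<in>UNIV. gen j * f j) = u + (\<Sum>i\<in>{8..Suc n}. rel i * c i) + (\<Sum>j\<in>UNIV. gen j * g j)"
      and eq': "(\<Sum>j\<in>UNIV. gen j * f' j) = u + (\<Sum>i\<in>{8..Suc n}. rel i * c i) + (\<Sum>j\<in>UNIV. gen j * g' j)"
      using R unfolding uc prod.case by blast
    have "(\<Sum>j\<in>UNIV. gen j * (f j - f' j)) = (\<Sum>j\<in>UNIV. gen j * (g j - g' j))"
      unfolding right_diff_distrib sum_subtractf eq eq' by (simp del: sum.cl_ivl_Suc)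
    then have "(\<lambda>j. f j - f' j) = (\<lambda>j. g j - g' j)"
      by (rule left_expansion_unique)
    then have diff: "f j - f' j \<in> J" for j
      using ideal_diff[OF ideal g[of j] g'[of j]] by (simp add: fun_eq_iff)
    show "f = f'"
    proof
      fix j
      have "f j \<in> reps n" "f' j \<in> reps n"
        using f f' by (auto dest: PiE_mem)
      then show "f j = f' j"
        using diff by (rule reps_eqI)
    qed
  qed
  then show ?thesis
    by (simp add: card_PiE card_cartesian_product)
qed

text \<open>
  No monomial of degree below 8 occurs in \<open>J\<close>, so distinct constants are incongruent.
\<close>

lemma card_reps_0: "CARD('p) \<le> card (reps 0)"
proof -
  have hom: "homogeneous 0 (Poly_Mapping.single 0 c :: ('d, 'p) free_algebra)" for c
    by (simp add: homogeneous_def lookup_single when_def)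
  have "inj (\<lambda>c. rep 0 (Poly_Mapping.single 0 c))"
  proof (rule injI)
    fix c c' :: "'p mod_ring"
    assume same: "rep 0 (Poly_Mapping.single 0 c) = rep 0 (Poly_Mapping.single 0 c')"
    have "Poly_Mapping.single 0 c - Poly_Mapping.single 0 c' \<in> J"
      using ideal_diff[OF ideal rep_cong[OF hom[of c]] rep_cong[OF hom[of c']]] same by simp
    then have "order_at_least 8 (Poly_Mapping.single 0 (c - c') :: ('d, 'p) free_algebra)"
      by (intro order_J) (simp add: single_diff)
    then show "c = c'"
      unfolding order_at_least_def by (drule_tac spec[of _ 0]) (simp add: lookup_single)
  qed
  then have "CARD('p mod_ring) \<le> card (reps 0)"
    by (rule card_inj_on_le) (auto simp: reps_def hom finite_reps[unfolded reps_def])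
  then show ?thesis by simp
qed

lemma reps_exponential_growth:
  assumes "2 \<le> CARD('d)"
  shows "(3 / 2) ^ n \<le> log CARD('p) (card (reps n))"
proof -
  let ?p = "real CARD('p)"
  have p: "1 < ?p"
    using prime_gt_1_nat[OF prime_card[where 'a = 'p]] by simp
  have pos: "0 < card (reps n)" for n
  proof -
    have "rep n 0 \<in> reps n"
      unfolding reps_def by (rule imageI) simp
    then show ?thesis
      using finite_reps[of n] by (auto simp: card_gt_0_iff)
  qed
  then have ge_1: "1 \<le> real (card (reps n))" for n
    using pos[of n] by linarith
  show ?thesis
  proof (rule golod_shafarevich_recursion_growth)
    show "1 \<le> log ?p (card (reps 0))"
      using card_reps_0 p pos by (simp add: le_log_iff)
    fix n
    let ?P = "\<Prod>i\<in>{8..Suc n}. real (card (reps (Suc n - i)))"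
    have P: "0 < ?P"
      by (rule prod_pos) (simp add: pos)
    have "real (card (reps n) ^ CARD('d))
        \<le> real (card (reps (Suc n)) * (\<Prod>i\<in>{8..Suc n}. card (reps (Suc n - i))))"
      using card_reps_Suc[of n] by (rule of_nat_mono)
    then have le: "real (card (reps n)) ^ CARD('d) \<le> real (card (reps (Suc n))) * ?P"
      unfolding of_nat_mult of_nat_power of_nat_prod .
    have "2 * log ?p (card (reps n)) \<le> real CARD('d) * log ?p (card (reps n))"
      using assms p ge_1 by (intro mult_right_mono) (simp_all add: zero_le_log_cancel_iff pos)
    also have "\<dots> = log ?p (real (card (reps n)) ^ CARD('d))"
      using pos by (simp add: log_nat_power)
    also have "\<dots> \<le> log ?p (real (card (reps (Suc n))) * ?P)"
      using p pos le by (intro log_mono) simp_all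
    also have "\<dots> = log ?p (card (reps (Suc n))) + log ?p ?P"
      using pos[of "Suc n"] P by (intro log_mult_pos) simp_all
    also have "log ?p ?P = (\<Sum>i\<in>{8..Suc n}. log ?p (card (reps (Suc n - i))))"
      unfolding log_def sum_divide_distrib[symmetric] using pos by (subst ln_prod) simp_all
    finally show "2 * log ?p (card (reps n))
        \<le> log ?p (card (reps (Suc n))) + (\<Sum>i = 8..Suc n. log ?p (card (reps (Suc n - i))))" .
  qed
qed

end

section \<open>Quotients of the free algebra\<close>

lemma
  fixes K :: "('d, 'p::prime_card) free_algebra set"
  assumes "ideal K free_algebra_ring"
  shows coset_eq_iff: "\<And>a b. K +>\<^bsub>free_algebra_ring\<^esub> a = K +>\<^bsub>free_algebra_ring\<^esub> b \<longleftrightarrow> a - b \<in> K"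
    and coset_mult: "\<And>a b. (K +>\<^bsub>free_algebra_ring\<^esub> a) \<otimes>\<^bsub>free_algebra_ring Quot K\<^esub> (K +>\<^bsub>free_algebra_ring\<^esub> b)
      = K +>\<^bsub>free_algebra_ring\<^esub> (a * b)"
    and coset_add: "\<And>a b. (K +>\<^bsub>free_algebra_ring\<^esub> a) \<oplus>\<^bsub>free_algebra_ring Quot K\<^esub> (K +>\<^bsub>free_algebra_ring\<^esub> b)
      = K +>\<^bsub>free_algebra_ring\<^esub> (a + b)"
    and coset_one: "\<one>\<^bsub>free_algebra_ring Quot K\<^esub> = K +>\<^bsub>free_algebra_ring\<^esub> 1"
    and carrier_quotient: "carrier (free_algebra_ring Quot K) = range (\<lambda>a. K +>\<^bsub>free_algebra_ring\<^esub> a)"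
proof -
  interpret K: ideal K free_algebra_ring by fact
  interpret H: ring_hom_ring free_algebra_ring "free_algebra_ring Quot K" "(+>\<^bsub>free_algebra_ring\<^esub>) K"
    by (rule K.rcos_ring_hom_ring)
  show "K +>\<^bsub>free_algebra_ring\<^esub> a = K +>\<^bsub>free_algebra_ring\<^esub> b \<longleftrightarrow> a - b \<in> K" for a b
    using K.quotient_eq_iff_same_a_r_cos[OF assms, of a b] by (simp add: a_minus_def a_inv_free_algebra)
  show "(K +>\<^bsub>free_algebra_ring\<^esub> a) \<otimes>\<^bsub>free_algebra_ring Quot K\<^esub> (K +>\<^bsub>free_algebra_ring\<^esub> b)
      = K +>\<^bsub>free_algebra_ring\<^esub> (a * b)" for a b
    using H.hom_mult[of a b] by simp
  show "(K +>\<^bsub>free_algebra_ring\<^esub> a) \<oplus>\<^bsub>free_algebra_ring Quot K\<^esub> (K +>\<^bsub>free_algebra_ring\<^esub> b)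
      = K +>\<^bsub>free_algebra_ring\<^esub> (a + b)" for a b
    using H.hom_add[of a b] by simp
  show "\<one>\<^bsub>free_algebra_ring Quot K\<^esub> = K +>\<^bsub>free_algebra_ring\<^esub> 1"
    using H.hom_one by simp
  show "carrier (free_algebra_ring Quot K) = range (\<lambda>a. K +>\<^bsub>free_algebra_ring\<^esub> a)"
    by (auto simp: FactRing_def A_RCOSETS_def')
qed

lemma constant_term_simps [simp]:
  "constant_term 0 = 0" "constant_term 1 = 1"
  "constant_term (a + b) = constant_term a + constant_term b"
  "constant_term (- a) = - constant_term a" "constant_term (a - b) = constant_term a - constant_term b"
  by (simp_all add: constant_term_def lookup_add lookup_minus)

lemma constant_term_gen_mult [simp]: "constant_term (gen j * a) = 0"
  using order_at_least_mult[OF order_at_least_gen[of j], of 0 a] by (simp add: order_at_least_1_iff)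

lemma constant_term_gen [simp]: "constant_term (gen j) = 0"
  using constant_term_gen_mult[of j 1] by simp

lemma constant_term_mult [simp]: "constant_term (a * b) = constant_term a * constant_term b"
  by (induction a rule: free_algebra_induct) (simp_all add: distrib_right mult.assoc)

lemma order_at_least_power:
  assumes "constant_term a = 0"
  shows "order_at_least n (a ^ n)"
proof (induction n)
  case (Suc n)
  then show ?case
    using order_at_least_mult[of "Suc 0" a n "a ^ n"] assms by (simp add: order_at_least_1_iff)
qed simp

lemma of_nat_CARD_free_algebra: "of_nat CARD('p) = (0 :: ('d, 'p::prime_card) free_algebra)"
  using single_of_nat[of "CARD('p)", where 'b = "'p mod_ring" and 'a = "'d monomial"] by simp

text \<open>
  This holds in noncommutative rings because \<open>1\<close> and \<open>a\<close> commute.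
\<close>

lemma binomial_one_plus:
  fixes a :: "'r::ring_1"
  shows "(1 + a) ^ n = (\<Sum>k\<le>n. of_nat (n choose k) * a ^ k)"
proof (induction n)
  case (Suc n)
  have "(\<Sum>k\<le>Suc n. of_nat (Suc n choose k) * a ^ k)
      = 1 + (\<Sum>k\<le>n. of_nat (n choose k) * a ^ Suc k + of_nat (n choose Suc k) * a ^ Suc k)"
    unfolding sum.atMost_Suc_shift by (simp add: distrib_right)
  also have "\<dots> = (1 + (\<Sum>k\<le>n. of_nat (n choose Suc k) * a ^ Suc k)) + (\<Sum>k\<le>n. of_nat (n choose k) * a ^ Suc k)"
    by (simp add: sum.distrib)
  also have "1 + (\<Sum>k\<le>n. of_nat (n choose Suc k) * a ^ Suc k) = (\<Sum>k\<le>Suc n. of_nat (n choose k) * a ^ k)"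
    by (simp only: sum.atMost_Suc_shift) simp
  also have "\<dots> = (\<Sum>k\<le>n. of_nat (n choose k) * a ^ k)"
    by (simp add: binomial_eq_0)
  also have "(\<Sum>k\<le>n. of_nat (n choose k) * a ^ Suc k) = (\<Sum>k\<le>n. of_nat (n choose k) * a ^ k) * a"
    by (simp add: sum_distrib_right mult.assoc power_commutes)
  finally show ?case
    unfolding Suc.IH[symmetric] by (simp add: distrib_left flip: power_commutes)
qed simp

lemma frobenius_one_plus:
  fixes a :: "'r::ring_1"
  assumes p: "normalization_semidom_class.prime p" and char: "of_nat p = (0 :: 'r)"
  shows "(1 + a) ^ p = 1 + a ^ p"
proof -
  have zero: "of_nat (p choose k) = (0 :: 'r)" if "0 < k" "k < p" for k
  proof -
    have "p dvd p choose k"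
      using that p by (intro dvd_choose_prime) auto
    then show ?thesis
      using char by (auto elim!: dvdE)
  qed
  have "(1 + a) ^ p = (\<Sum>k\<le>p. of_nat (p choose k) * a ^ k)"
    by (rule binomial_one_plus)
  also have "\<dots> = (\<Sum>k\<in>{0, p}. of_nat (p choose k) * a ^ k)"
    by (rule sum.mono_neutral_right) (auto simp: zero)
  also have "\<dots> = 1 + a ^ p"
    using prime_gt_0_nat[OF p] by simp
  finally show ?thesis .
qed

lemma frobenius_power_one_plus:
  fixes a :: "'r::ring_1"
  assumes "normalization_semidom_class.prime p" "of_nat p = (0 :: 'r)"
  shows "(1 + a) ^ (p ^ n) = 1 + a ^ (p ^ n)"
proof (induction n)
  case (Suc n)
  have "(1 + a) ^ (p ^ Suc n) = ((1 + a) ^ (p ^ n)) ^ p"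
    by (simp add: mult.commute flip: power_mult)
  also have "\<dots> = 1 + (a ^ (p ^ n)) ^ p"
    unfolding Suc.IH by (rule frobenius_one_plus[OF assms])
  finally show ?case
    by (simp add: mult.commute flip: power_mult)
qed simp

section \<open>The Golod ideal\<close>

locale golod =
  fixes y :: "nat \<Rightarrow> ('d::finite, 'p::prime_card) free_algebra"
    and l :: "nat \<Rightarrow> nat"
  assumes data: "golod_data y l"
begin

lemma constant_term_y: "constant_term (y (Suc k)) = 0"
proof -
  have "y (Suc k) \<in> y ` {1..}"
    by (rule imageI) simp
  also have "y ` {1..} = {a. constant_term a = 0}"
    using data unfolding golod_data_def by (rule conjunct1)
  finally show ?thesis by simp
qed

text \<open>
  The number 8 arises as \<open>2 ^ 3\<close>, from \<open>p \<ge> 2\<close> and \<open>l (Suc k) \<ge> 3\<close>.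
\<close>

lemma order_relator_source:
  assumes "\<not> nilpotent_mod (golod_stage y l k) (y (Suc k))"
  shows "order_at_least 8 (relator_source y l (Suc k))"
proof -
  have "(8 :: nat) = 2 ^ 3"
    by simp
  also have "\<dots> \<le> CARD('p) ^ 3"
    using prime_ge_2_nat[OF prime_card[where 'a = 'p]] by (rule power_mono) simp
  also have "\<dots> \<le> CARD('p) ^ l (Suc k)"
    using data assms prime_gt_0_nat[OF prime_card[where 'a = 'p]]
    by (intro power_increasing) (simp_all add: golod_data_def)
  finally show ?thesis
    unfolding relator_source_def
    by (rule order_at_least_mono[OF order_at_least_power[OF constant_term_y]])
qed

lemma golod_relators_mono: "i \<le> j \<Longrightarrow> golod_relators y l i \<subseteq> golod_relators y l j"
  by (rule lift_Suc_mono_le[of "golod_relators y l"]) auto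

lemma golod_relators_in_stage: "golod_relators y l k \<subseteq> golod_stage y l k"
proof (induction k)
  case (Suc k)
  then show ?case
    using ring.genideal_self[OF ring_free_algebra,
        of "golod_stage y l k \<union> homogeneous_parts (relator_source y l (Suc k))"]
    by auto
qed simp

lemma golod_relatorE:
  assumes "r \<in> golod_relators y l m"
  obtains k n where "k < m" "\<not> nilpotent_mod (golod_stage y l k) (y (Suc k))"
    "r = homogeneous_part n (relator_source y l (Suc k))" "r \<in> golod_relators y l (Suc k)"
  using assms
proof (induction m)
  case (Suc m)
  show ?case
  proof (cases "r \<in> golod_relators y l m")
    case True
    then show ?thesis
      using Suc.IH Suc.prems(1) less_Suc_eq by blast
  next
    case False
    then have "\<not> nilpotent_mod (golod_stage y l m) (y (Suc m))"
      "r \<in> homogeneous_parts (relator_source y l (Suc m))"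
      using Suc.prems(2) by (auto split: if_splits)
    then show ?thesis
      using Suc.prems unfolding homogeneous_parts_def by blast
  qed
qed simp

text \<open>
  The exponent \<open>l (Suc k)\<close> was chosen so large that the new power has no monomial whose degree already
  occurs in an earlier relator.
\<close>

lemma golod_relator_degree:
  assumes "r \<in> golod_relators y l k" "\<not> nilpotent_mod (golod_stage y l k) (y (Suc k))"
    and "homogeneous i r" "r \<noteq> 0"
  shows "homogeneous_part i (relator_source y l (Suc k)) = 0"
proof (rule poly_mapping_eqI, rule ccontr)
  fix w
  assume "Poly_Mapping.lookup (homogeneous_part i (relator_source y l (Suc k))) w \<noteq> Poly_Mapping.lookup 0 w"
  then have w: "w \<in> Poly_Mapping.keys (relator_source y l (Suc k))" "mdegree w = i"
    by (auto simp: lookup_homogeneous_part in_keys_iff split: if_splits)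
  obtain v where v: "v \<in> Poly_Mapping.keys r"
    using \<open>r \<noteq> 0\<close> by (metis ex_in_conv keys_eq_empty)
  then have "mdegree v < mdegree w"
    using data assms(1,2) w(1) unfolding golod_data_def by blast
  moreover have "mdegree v = i"
    using v assms(3) by (simp add: homogeneous_def in_keys_iff)
  ultimately show False
    using w by simp
qed

lemma golod_relator_unique:
  assumes r: "r \<in> golod_relators y l m" "homogeneous i r" "r \<noteq> 0"
    and r': "r' \<in> golod_relators y l m'" "homogeneous i r'" "r' \<noteq> 0"
  shows "r = r'"
proof -
  obtain k n where k: "\<not> nilpotent_mod (golod_stage y l k) (y (Suc k))"
    "r = homogeneous_part n (relator_source y l (Suc k))" "r \<in> golod_relators y l (Suc k)"
    using r(1) by (rule golod_relatorE)
  obtain k' n' where k': "\<not> nilpotent_mod (golod_stage y l k') (y (Suc k'))"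
    "r' = homogeneous_part n' (relator_source y l (Suc k'))" "r' \<in> golod_relators y l (Suc k')"
    using r'(1) by (rule golod_relatorE)
  have n: "n = i" and n': "n' = i"
    using homogeneous_degree_unique r r' k(2) k'(2) homogeneous_homogeneous_part by metis+
  consider "k = k'" | "k < k'" | "k' < k"
    by linarith
  then show ?thesis
  proof cases
    case 1
    then show ?thesis
      unfolding k(2) k'(2) n n' by simp
  next
    case 2
    then have "r \<in> golod_relators y l k'"
      using golod_relators_mono[of "Suc k" k'] k(3) by (meson Suc_leI subsetD)
    then have "r' = 0"
      unfolding k'(2) n' by (rule golod_relator_degree) (fact k' r)+
    with r'(3) show ?thesis by contradiction
  next
    case 3
    then have "r' \<in> golod_relators y l k"
      using golod_relators_mono[of "Suc k'" k] k'(3) by (meson Suc_leI subsetD)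
    then have "r = 0"
      unfolding k(2) n by (rule golod_relator_degree) (fact k r')+
    with r(3) show ?thesis by contradiction
  qed
qed

text \<open>
  The relator of degree \<open>i\<close>, which is unique by \<open>golod_relator_unique\<close>, or \<open>0\<close> if there is none.
\<close>

definition rel :: "nat \<Rightarrow> ('d, 'p) free_algebra"
  where "rel i = (if \<exists>r m. r \<in> golod_relators y l m \<and> homogeneous i r \<and> r \<noteq> 0
    then SOME r. (\<exists>m. r \<in> golod_relators y l m) \<and> homogeneous i r \<and> r \<noteq> 0 else 0)"

lemma rel_cases: 
  obtains "rel i = 0" | m where "rel i \<in> golod_relators y l m" "homogeneous i (rel i)" "rel i \<noteq> 0"
proof (cases "\<exists>r m. r \<in> golod_relators y l m \<and> homogeneous i r \<and> r \<noteq> 0")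
  case True
  then have "\<exists>r. (\<exists>m. r \<in> golod_relators y l m) \<and> homogeneous i r \<and> r \<noteq> 0"
    by blast
  then have "(\<exists>m. rel i \<in> golod_relators y l m) \<and> homogeneous i (rel i) \<and> rel i \<noteq> 0"
    unfolding rel_def if_P[OF True] by (rule someI_ex)
  then show thesis
    using that by blast
next
  case False
  then have "rel i = 0"
    unfolding rel_def by (rule if_not_P)
  then show thesis
    by (rule that)
qed

lemma rel_eq_relator:
  assumes "r \<in> golod_relators y l m" "homogeneous i r" "r \<noteq> 0"
  shows "rel i = r"
proof (cases i rule: rel_cases)
  case 1
  have ex: "\<exists>r m. r \<in> golod_relators y l m \<and> homogeneous i r \<and> r \<noteq> 0"
    using assms by blast
  then have "\<exists>r. (\<exists>m. r \<in> golod_relators y l m) \<and> homogeneous i r \<and> r \<noteq> 0"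
    by blast
  then have "rel i \<noteq> 0"
    unfolding rel_def if_P[OF ex] by (rule someI2_ex) simp
  with 1 show ?thesis by contradiction
next
  case 2
  then show ?thesis
    using golod_relator_unique assms by blast
qed

lemma golod_ideal_minimal:
  assumes K: "ideal K free_algebra_ring" and rel: "\<And>i. rel i \<in> K"
  shows "golod_ideal y l \<subseteq> K"
proof -
  have "golod_stage y l k \<subseteq> K" for k
  proof (induction k)
    case 0
    show ?case using ideal_zero[OF K] by simp
  next
    case (Suc k)
    show ?case
    proof (cases "nilpotent_mod (golod_stage y l k) (y (Suc k))")
      case False
      have "homogeneous_parts (relator_source y l (Suc k)) \<subseteq> K"
      proof
        fix r
        assume r: "r \<in> homogeneous_parts (relator_source y l (Suc k))"
        then obtain i where "r = homogeneous_part i (relator_source y l (Suc k))"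
          unfolding homogeneous_parts_def by blast
        then have "homogeneous i r" by simp
        moreover have "r \<in> golod_relators y l (Suc k)"
          using r False by simp
        ultimately show "r \<in> K"
          using rel_eq_relator rel ideal_zero[OF K] by metis
      qed
      then show ?thesis
        using False Suc.IH ring.genideal_minimal[OF ring_free_algebra K] by simp
    qed (use Suc.IH in simp)
  qed
  then show ?thesis
    unfolding golod_ideal_def by blast
qed

sublocale sparse_graded_ideal "golod_ideal y l" rel
proof (rule sparse_graded_ideal.intro)
  show "ideal (golod_ideal y l) free_algebra_ring"
    by (rule ideal_golod_ideal)
  show "rel i \<in> golod_ideal y l" for i
  proof (cases i rule: rel_cases)
    case 1
    then show ?thesis
      using ideal_zero[OF ideal_golod_ideal[of y l]] by simp
  next
    case (2 m)
    then show ?thesis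
      using golod_relators_in_stage unfolding golod_ideal_def by blast
  qed
  show "homogeneous i (rel i)" for i
    by (cases i rule: rel_cases) simp_all
  show "rel i = 0" if "i < 8" for i
  proof (cases i rule: rel_cases)
    case (2 m)
    obtain k n where k: "\<not> nilpotent_mod (golod_stage y l k) (y (Suc k))"
      and rel: "rel i = homogeneous_part n (relator_source y l (Suc k))"
      using 2(1) by (rule golod_relatorE)
    have "homogeneous_part i (rel i) = 0"
      using order_relator_source[OF k] that unfolding rel
      by (intro poly_mapping_eqI) (force simp: lookup_homogeneous_part order_at_least_def)
    then show ?thesis
      using 2(2) homogeneous_part_homogeneous by metis
  qed
  show "golod_ideal y l \<subseteq> K" if "ideal K free_algebra_ring" "\<And>i. rel i \<in> K" for K
    using that by (rule golod_ideal_minimal)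
qed

text \<open>
  The purpose of the construction: \<open>a\<close> occurs in the enumeration, and at its stage either it is already
  nilpotent or all homogeneous parts of one of its powers become relators. Raising to a further power
  gives an exponent of the form \<open>p ^ n\<close>.
\<close>

lemma nilpotent_modulo_golod_ideal:
  assumes "constant_term a = 0"
  shows "\<exists>n. a ^ (CARD('p) ^ n) \<in> golod_ideal y l"
proof -
  have "y ` {1..} = {a. constant_term a = 0}"
    using data unfolding golod_data_def by (rule conjunct1)
  then have "a \<in> y ` {1..}"
    using assms by blast
  then obtain k' where "1 \<le> k'" "a = y k'"
    by auto
  then obtain k where k: "a = y (Suc k)"
    by (cases k') auto
  have "\<exists>n. a ^ n \<in> golod_stage y l (Suc k)"
  proof (cases "nilpotent_mod (golod_stage y l k) (y (Suc k))")
    case True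
    then show ?thesis
      by (simp add: nilpotent_mod_iff[OF ideal_golod_stage] k)
  next
    case False
    let ?r = "relator_source y l (Suc k)"
    have parts: "homogeneous_part n ?r \<in> golod_stage y l (Suc k)" for n
      using False golod_relators_in_stage[of "Suc k"] by (auto simp: homogeneous_parts_def)
    obtain N where "?r = (\<Sum>n<N. homogeneous_part n ?r)"
      using sum_homogeneous_parts by blast
    also have "\<dots> \<in> golod_stage y l (Suc k)"
      by (rule ideal_sum[OF ideal_golod_stage parts])
    finally show ?thesis
      unfolding relator_source_def k by blast
  qed
  then obtain n where n: "a ^ n \<in> golod_ideal y l"
    unfolding golod_ideal_def by blast
  have "n < CARD('p) ^ n"
    by (rule power_gt_expt) (use prime_gt_1_nat[OF prime_card[where 'a = 'p]] in simp)
  then have "a ^ (CARD('p) ^ n) = a ^ (CARD('p) ^ n - n) * a ^ n"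
    by (simp flip: power_add)
  then show ?thesis
    using ideal_mult_left[OF ideal n] by metis
qed

section \<open>The Golod group\<close>

abbreviation B :: "('d, 'p) free_algebra set ring"
  where "B \<equiv> golod_algebra y l"

abbreviation G :: "('d, 'p) free_algebra set monoid"
  where "G \<equiv> golod_group y l"

definition cls :: "('d, 'p) free_algebra \<Rightarrow> ('d, 'p) free_algebra set"
  where "cls a = golod_ideal y l +>\<^bsub>free_algebra_ring\<^esub> a"

lemma cls_eq_iff: "cls a = cls b \<longleftrightarrow> a - b \<in> golod_ideal y l"
  unfolding cls_def by (rule coset_eq_iff[OF ideal])

lemma B_mult: "cls a \<otimes>\<^bsub>B\<^esub> cls b = cls (a * b)"
  unfolding cls_def golod_algebra_def by (rule coset_mult[OF ideal])

lemma B_one: "\<one>\<^bsub>B\<^esub> = cls 1"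
  unfolding cls_def golod_algebra_def by (rule coset_one[OF ideal])

lemma carrier_B: "carrier B = range cls"
  unfolding cls_def golod_algebra_def by (rule carrier_quotient[OF ideal])

lemma golod_generator_eq: "golod_generator y l i = cls (1 + gen i)"
  unfolding golod_generator_def B_one unfolding cls_def golod_algebra_def by (rule coset_add[OF ideal])

lemma group_units_B: "group (units_of B)"
  by (rule monoid.units_group[OF ring.is_monoid[OF ring_golod_algebra]])

lemma group_G: "group G"
  unfolding golod_group_def by (rule group.group_subgroup_generated[OF group_units_B])

lemma G_mult [simp]: "x \<otimes>\<^bsub>G\<^esub> z = x \<otimes>\<^bsub>B\<^esub> z" and G_one: "\<one>\<^bsub>G\<^esub> = cls 1"
  by (simp_all add: golod_group_def units_of_mult units_of_one B_one)

lemma range_golod_generator: "range (golod_generator y l) \<subseteq> carrier (units_of B)"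
  using golod_generator_unit[OF data] by blast

lemma carrier_G: "carrier G = generate (units_of B) (range (golod_generator y l))"
  using range_golod_generator by (simp add: golod_group_def carrier_subgroup_generated Int_absorb1)

text \<open>
  Elements with constant term 1 are closed under products. For inverses the point is that \<open>J\<close> has no
  elements with a nonzero constant term, so that constant terms are well defined modulo \<open>J\<close>.
\<close>

lemma ex_lift:
  assumes "g \<in> carrier G"
  shows "\<exists>b. constant_term b = 1 \<and> cls b = g"
  using assms unfolding carrier_G
proof (induction rule: generate.induct)
  case one
  show ?case
    by (rule exI[of _ 1]) (simp add: units_of_one B_one)
next
  case (incl h)
  then obtain i where "h = golod_generator y l i"
    by blast
  then show ?case
    unfolding golod_generator_eq by (intro exI[of _ "1 + gen i"]) simp
next
  case (inv h)
  then have range: "h \<in> range (golod_generator y l)" .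
  then obtain i where "h = golod_generator y l i"
    by blast
  then have h: "h = cls (1 + gen i)"
    unfolding golod_generator_eq .
  have unit: "h \<in> carrier (units_of B)"
    by (rule subsetD[OF range_golod_generator range])
  have "inv\<^bsub>units_of B\<^esub> h \<in> carrier (units_of B)"
    by (rule group.inv_closed[OF group_units_B unit])
  then obtain b where b: "inv\<^bsub>units_of B\<^esub> h = cls b"
    by (auto simp: units_of_def Units_def carrier_B)
  have "cls b \<otimes>\<^bsub>B\<^esub> h = \<one>\<^bsub>B\<^esub>"
    using group.l_inv[OF group_units_B unit] by (simp add: units_of_mult units_of_one b)
  then have "b * (1 + gen i) - 1 \<in> golod_ideal y l"
    by (simp add: h B_mult B_one cls_eq_iff)
  then have "order_at_least (Suc 0) (b * (1 + gen i) - 1)"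
    by (rule order_at_least_mono[OF order_J]) simp
  then have "constant_term b = 1"
    unfolding order_at_least_1_iff by simp
  then show ?case
    using b by (intro exI[of _ b] conjI) simp_all
next
  case (eng h1 h2)
  then show ?case
    by (metis (no_types, opaque_lifting) B_mult constant_term_mult mult.right_neutral units_of_mult)
qed

definition lift :: "('d, 'p) free_algebra set \<Rightarrow> ('d, 'p) free_algebra"
  where "lift g = (SOME b. constant_term b = 1 \<and> cls b = g)"

lemma
  assumes "g \<in> carrier G"
  shows constant_term_lift: "constant_term (lift g) = 1" and cls_lift: "cls (lift g) = g"
  using someI_ex[OF ex_lift[OF assms]] unfolding lift_def by blast+

lemma G_pow: "cls b [^]\<^bsub>G\<^esub> (n::nat) = cls (b ^ n)"
proof (induction n)
  case 0
  show ?case by (simp add: nat_pow_def G_one)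
next
  case (Suc n)
  then show ?case
    by (simp add: nat_pow_def B_mult power_commutes)
qed

text \<open>
  For \<open>b\<close> with constant term 1 the element \<open>b - 1\<close> is nilpotent modulo \<open>J\<close>, and in characteristic \<open>p\<close> the
  \<open>p ^ n\<close>-th power of \<open>b = 1 + (b - 1)\<close> is \<open>1 + (b - 1) ^ (p ^ n)\<close>.
\<close>

lemma p_group_G: "p_group CARD('p) G"
  unfolding p_group_def
proof (intro conjI ballI group_G)
  fix g
  assume g: "g \<in> carrier G"
  then obtain b where b: "constant_term b = 1" "g = cls b"
    using ex_lift by blast
  obtain n where n: "(b - 1) ^ (CARD('p) ^ n) \<in> golod_ideal y l"
    using nilpotent_modulo_golod_ideal[of "b - 1"] b(1) by auto
  have "b ^ (CARD('p) ^ n) = 1 + (b - 1) ^ (CARD('p) ^ n)"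
    using frobenius_power_one_plus[OF prime_card[where 'a = 'p] of_nat_CARD_free_algebra, of "b - 1" n] by simp
  then have "g [^]\<^bsub>G\<^esub> (CARD('p) ^ n) = \<one>\<^bsub>G\<^esub>"
    using n by (simp add: b(2) G_pow G_one cls_eq_iff)
  then have "group.ord G g dvd CARD('p) ^ n"
    using group.pow_eq_id[OF group_G g] by blast
  then show "\<exists>k. group.ord G g = CARD('p) ^ k"
    using divides_primepow_nat[OF prime_card[where 'a = 'p]] by blast
qed

lemma finitely_generated_G: "finitely_generated_group G"
  unfolding finitely_generated_group_def
proof (intro conjI exI[of _ "range (golod_generator y l)"] group_G)
  show "range (golod_generator y l) \<subseteq> carrier G"
    unfolding carrier_G by (auto intro: generate.incl)
  have "subgroup_generated G (range (golod_generator y l)) = G"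
    unfolding golod_group_def by (rule group.subgroup_generated2[OF group_units_B])
  then have "carrier G = generate G (carrier G \<inter> range (golod_generator y l))"
    by (metis carrier_subgroup_generated)
  then show "generate G (range (golod_generator y l)) = carrier G"
    using \<open>range (golod_generator y l) \<subseteq> carrier G\<close> by (simp add: Int_absorb1)
qed simp

text \<open>
  The sum of \<open>J\<close> and of all elements whose monomials have degree above \<open>n\<close>, described by homogeneous
  parts. It has finite index since only the finitely many monomials of degree at most \<open>n\<close> matter.
\<close>

definition truncated_ideal :: "nat \<Rightarrow> ('d, 'p) free_algebra set"
  where "truncated_ideal n = {a. \<forall>m\<le>n. homogeneous_part m a \<in> golod_ideal y l}"

lemma ideal_truncated_ideal: "ideal (truncated_ideal n) free_algebra_ring"
proof (rule ideal_free_algebraI)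
  fix a j
  assume a: "a \<in> truncated_ideal n"
  have "homogeneous_part m (gen j * a) \<in> golod_ideal y l" "homogeneous_part m (a * gen j) \<in> golod_ideal y l"
    if "m \<le> n" for m
    using a that by (cases m; simp add: truncated_ideal_def ideal_zero[OF ideal] ideal_mult_left[OF ideal]
        ideal_mult_right[OF ideal])+
  then show "gen j * a \<in> truncated_ideal n" "a * gen j \<in> truncated_ideal n"
    by (simp_all add: truncated_ideal_def)
qed (simp_all add: truncated_ideal_def homogeneous_part_add ideal_zero[OF ideal] ideal_add[OF ideal])

lemma golod_ideal_subset_truncated: "golod_ideal y l \<subseteq> truncated_ideal n"
  by (auto simp: truncated_ideal_def homogeneous_part_in_J)

lemma finite_truncated_quotient: "finite (carrier (free_algebra_ring Quot truncated_ideal n))"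
proof -
  let ?c = "\<lambda>a. truncated_ideal n +>\<^bsub>free_algebra_ring\<^esub> a"
  let ?F = "{a :: ('d, 'p) free_algebra. \<forall>w. Poly_Mapping.lookup a w \<noteq> 0 \<longrightarrow> mdegree w \<le> n}"
  have "range ?c \<subseteq> ?c ` ?F"
  proof (rule image_subsetI)
    fix a :: "('d, 'p) free_algebra"
    define t where "t = (\<Sum>m\<le>n. homogeneous_part m a)"
    have lookup_t: "Poly_Mapping.lookup t w = (if mdegree w \<le> n then Poly_Mapping.lookup a w else 0)" for w
      by (simp add: t_def lookup_sum lookup_homogeneous_part)
    have "homogeneous_part m (a - t) = 0" if "m \<le> n" for m
      using that by (intro poly_mapping_eqI) (simp add: lookup_homogeneous_part lookup_minus lookup_t)
    then have "a - t \<in> truncated_ideal n"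
      by (simp add: truncated_ideal_def ideal_zero[OF ideal])
    then have "?c a = ?c t"
      by (simp add: coset_eq_iff[OF ideal_truncated_ideal])
    moreover have "t \<in> ?F"
      by (simp add: lookup_t)
    ultimately show "?c a \<in> ?c ` ?F"
      by blast
  qed
  then show ?thesis
    unfolding carrier_quotient[OF ideal_truncated_ideal]
    by (rule finite_subset) (intro finite_imageI finite_bounded_degree)
qed

text \<open>
  If \<open>lift g - 1\<close> is not in \<open>J\<close>, some homogeneous part of it, say of degree \<open>n\<close>, is not in \<open>J\<close> either. Reduction
  modulo \<open>truncated_ideal n\<close> maps \<open>G\<close> to the units of a finite ring, and \<open>g\<close> is not in the kernel.
\<close>

lemma residually_finite_G: "residually_finite_group G"
  unfolding residually_finite_group_def
proof (intro conjI ballI impI group_G)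
  fix g
  assume g: "g \<in> carrier G" "g \<noteq> \<one>\<^bsub>G\<^esub>"
  interpret G: group G by (rule group_G)
  have not_in: "lift g - 1 \<notin> golod_ideal y l"
    using g cls_lift[OF g(1)] by (metis G_one cls_eq_iff)
  obtain N where N: "lift g - 1 = (\<Sum>n<N. homogeneous_part n (lift g - 1))"
    using sum_homogeneous_parts by blast
  obtain n where n: "homogeneous_part n (lift g - 1) \<notin> golod_ideal y l"
    using not_in ideal_sum[OF ideal, of "{..<N}" "\<lambda>n. homogeneous_part n (lift g - 1)"] N by auto
  let ?K = "truncated_ideal n"
  let ?Q = "free_algebra_ring Quot ?K"
  define h where "h x = ?K +>\<^bsub>free_algebra_ring\<^esub> lift x" for x
  note K = ideal_truncated_ideal[of n]
  \<comment> \<open>\<open>h\<close> does not depend on the choice of lifts, since \<open>J\<close> is contained in the truncated ideal.\<close>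
  have h_eq: "h x = ?K +>\<^bsub>free_algebra_ring\<^esub> a" if "x \<in> carrier G" "cls a = x" for x a
    unfolding h_def coset_eq_iff[OF K]
    using that cls_lift[OF that(1)] golod_ideal_subset_truncated by (metis cls_eq_iff subsetD)
  have h_mult: "h (x \<otimes>\<^bsub>G\<^esub> z) = h x \<otimes>\<^bsub>?Q\<^esub> h z" if "x \<in> carrier G" "z \<in> carrier G" for x z
  proof -
    have "h (x \<otimes>\<^bsub>G\<^esub> z) = ?K +>\<^bsub>free_algebra_ring\<^esub> (lift x * lift z)"
      using that by (intro h_eq G.m_closed) (simp_all add: cls_lift flip: B_mult)
    then show ?thesis
      by (simp add: h_def coset_mult[OF K])
  qed
  have h_one: "h \<one>\<^bsub>G\<^esub> = \<one>\<^bsub>?Q\<^esub>"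
    unfolding coset_one[OF K] by (rule h_eq) (simp_all add: G_one[symmetric])
  have h_carrier: "h x \<in> carrier ?Q" for x
    by (simp add: h_def carrier_quotient[OF K])
  have h_unit: "h x \<in> Units ?Q" if "x \<in> carrier G" for x
  proof -
    have "h (inv\<^bsub>G\<^esub> x) \<otimes>\<^bsub>?Q\<^esub> h x = \<one>\<^bsub>?Q\<^esub>" "h x \<otimes>\<^bsub>?Q\<^esub> h (inv\<^bsub>G\<^esub> x) = \<one>\<^bsub>?Q\<^esub>"
      using h_mult[of "inv\<^bsub>G\<^esub> x" x] h_mult[of x "inv\<^bsub>G\<^esub> x"] that G.l_inv[of x] G.r_inv[of x] h_one
      by simp_all
    then show ?thesis
      unfolding Units_def using h_carrier by blast
  qed
  have "group (units_of ?Q)"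
    by (rule monoid.units_group[OF ring.is_monoid[OF ideal.quotient_is_ring[OF K]]])
  then interpret H: group_hom G "units_of ?Q" h
    by (intro group_hom.intro group_hom_axioms.intro group_G homI)
      (simp_all add: units_of_carrier units_of_mult h_unit h_mult del: G_mult)
  let ?N = "kernel G (units_of ?Q) h"
  have fin: "finite (carrier (units_of ?Q))"
    by (rule finite_subset[OF _ finite_truncated_quotient[of n]]) (auto simp: units_of_carrier Units_def)
  have image: "(\<lambda>Z. the_elem (h ` Z)) ` (rcosets\<^bsub>G\<^esub> ?N) \<subseteq> carrier (units_of ?Q)"
    using H.FactGroup_the_elem_mem by (auto simp: FactGroup_def)
  have "inj_on (\<lambda>Z. the_elem (h ` Z)) (rcosets\<^bsub>G\<^esub> ?N)"
    using H.FactGroup_inj_on by (simp add: FactGroup_def)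
  then have "finite (rcosets\<^bsub>G\<^esub> ?N)"
    using image fin by (rule inj_on_finite)
  moreover have "g \<notin> ?N"
  proof
    assume "g \<in> ?N"
    then have "h g = \<one>\<^bsub>?Q\<^esub>"
      by (simp add: kernel_def units_of_one)
    then have "lift g - 1 \<in> ?K"
      by (simp add: h_def coset_one[OF K] coset_eq_iff[OF K])
    then show False
      using n by (simp add: truncated_ideal_def)
  qed
  ultimately show "\<exists>N. N \<lhd> G \<and> finite (rcosets\<^bsub>G\<^esub> N) \<and> g \<notin> N"
    using H.normal_kernel by blast
qed

end

section \<open>Word growth of groups\<close>

definition word_ball :: "('a, 'b) monoid_scheme \<Rightarrow> 'a set \<Rightarrow> nat \<Rightarrow> 'a set"
  where "word_ball H S n = {word_product H ws | ws. ws \<in> lists S \<and> length ws \<le> n}"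

lemma growth_function_eq_card: "growth_function H S n = card (word_ball H S n)"
  by (simp add: growth_function_def word_ball_def)

lemma finite_word_ball:
  assumes "finite S"
  shows "finite (word_ball H S n)"
proof -
  have "word_ball H S n = word_product H ` {ws. set ws \<subseteq> S \<and> length ws \<le> n}"
    by (auto simp: word_ball_def)
  then show ?thesis
    using finite_lists_length_le[OF assms, of n] by simp
qed

lemma one_in_word_ball: "\<one>\<^bsub>H\<^esub> \<in> word_ball H S n"
  unfolding word_ball_def by (intro CollectI exI[of _ "[]"]) (simp add: word_product_def)

lemma word_ball_mono: "m \<le> n \<Longrightarrow> word_ball H S m \<subseteq> word_ball H S n"
  by (force simp: word_ball_def)

lemma word_ball_mult:
  assumes "s \<in> S" "g \<in> word_ball H S n"
  shows "s \<otimes>\<^bsub>H\<^esub> g \<in> word_ball H S (Suc n)"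
proof -
  obtain ws where "g = word_product H ws" "ws \<in> lists S" "length ws \<le> n"
    using assms(2) by (auto simp: word_ball_def)
  then show ?thesis
    unfolding word_ball_def using assms(1)
    by (intro CollectI exI[of _ "s # ws"]) (simp add: word_product_def)
qed

context monoid
begin

lemma word_product_closed:
  assumes "S \<subseteq> carrier G" "ws \<in> lists S"
  shows "word_product G ws \<in> carrier G"
  using assms(2) by (induction ws) (use assms(1) in \<open>auto simp: word_product_def\<close>)

lemma word_product_append:
  assumes "S \<subseteq> carrier G" "us \<in> lists S" "vs \<in> lists S"
  shows "word_product G (us @ vs) = word_product G us \<otimes> word_product G vs"
  using assms(2)
proof (induction us)
  case Nil
  then show ?case
    using word_product_closed[OF assms(1,3)] by (simp add: word_product_def)
next
  case (Cons s us)
  then show ?case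
    using word_product_closed[OF assms(1,3)] word_product_closed[OF assms(1), of us] assms(1)
    by (simp add: word_product_def subset_iff m_assoc)
qed

lemma word_ball_closed: "S \<subseteq> carrier G \<Longrightarrow> word_ball G S n \<subseteq> carrier G"
  using word_product_closed by (auto simp: word_ball_def)

lemma growth_function_submultiplicative:
  assumes S: "S \<subseteq> carrier G" "finite S"
  shows "growth_function G S (m + n) \<le> growth_function G S m * growth_function G S n"
proof -
  have "word_ball G S (m + n) \<subseteq> (\<lambda>(g, h). g \<otimes> h) ` (word_ball G S m \<times> word_ball G S n)"
  proof
    fix g
    assume "g \<in> word_ball G S (m + n)"
    then obtain ws where ws: "g = word_product G ws" "ws \<in> lists S" "length ws \<le> m + n"
      by (auto simp: word_ball_def)
    have lists: "take m ws \<in> lists S" "drop m ws \<in> lists S"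
      using ws(2) by (auto dest: in_set_takeD in_set_dropD)
    have "g = word_product G (take m ws) \<otimes> word_product G (drop m ws)"
      using word_product_append[OF S(1) lists] ws(1) by simp
    moreover have "word_product G (take m ws) \<in> word_ball G S m"
      "word_product G (drop m ws) \<in> word_ball G S n"
      unfolding word_ball_def using lists ws(3) by force+
    ultimately show "g \<in> (\<lambda>(g, h). g \<otimes> h) ` (word_ball G S m \<times> word_ball G S n)"
      by blast
  qed
  then have "card (word_ball G S (m + n)) \<le> card (word_ball G S m \<times> word_ball G S n)"
    by (rule surj_card_le[rotated]) (intro finite_cartesian_product finite_word_ball S)
  then show ?thesis
    by (simp add: growth_function_eq_card card_cartesian_product)
qed

lemma growth_rate_ge:
  assumes S: "S \<subseteq> carrier G" "finite S"
    and c: "0 \<le> c" "\<And>n. c ^ n \<le> real (growth_function G S n)"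
  shows "c \<le> growth_rate G S"
proof -
  let ?u = "\<lambda>n. real (growth_function G S n)"
  have "1 \<le> ?u n" for n
  proof -
    have "0 < card (word_ball G S n)"
      using one_in_word_ball[of G S n] finite_word_ball[OF S(2), of G n] by (auto simp: card_gt_0_iff)
    then show ?thesis
      unfolding growth_function_eq_card by linarith
  qed
  moreover have "?u (m + n) \<le> ?u m * ?u n" for m n
    using growth_function_submultiplicative[OF S, of m n] by (simp flip: of_nat_mult)
  ultimately have "convergent (\<lambda>n. root n (?u n))"
    by (rule submultiplicative_root_convergent)
  then have "(\<lambda>n. root n (?u n)) \<longlonglongrightarrow> growth_rate G S"
    unfolding growth_rate_def by (rule convergent_LIMSEQ_iff[THEN iffD1])
  moreover have "c \<le> root n (?u n)" if "1 \<le> n" for n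
  proof -
    have "c = root n (c ^ n)"
      using that c(1) by (simp add: real_root_power_cancel)
    also have "\<dots> \<le> root n (?u n)"
      using that c(2) by (intro real_root_le_mono) simp_all
    finally show ?thesis .
  qed
  ultimately show ?thesis
    by (intro LIMSEQ_le_const) auto
qed

end

text \<open>
  Adding the inverses and \<open>\<one>\<close> to a set of group generators makes every element a nonempty product.
\<close>

lemma (in group) finite_semigroup_generating_set:
  assumes "finitely_generated_group G"
  shows "\<exists>S. finite S \<and> semigroup_generating_set G S"
proof -
  obtain A where A: "finite A" "A \<subseteq> carrier G" "generate G A = carrier G"
    using assms by (auto simp: finitely_generated_group_def)
  define S where "S = insert \<one> (A \<union> m_inv G ` A)"
  have S: "S \<subseteq> carrier G"
    using A(2) by (auto simp: S_def)
  have single: "\<exists>ws. s = word_product G ws \<and> ws \<in> lists S \<and> ws \<noteq> []" if "s \<in> S" for s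
    using that S by (intro exI[of _ "[s]"]) (auto simp: word_product_def)
  have "\<exists>ws. g = word_product G ws \<and> ws \<in> lists S \<and> ws \<noteq> []" if "g \<in> generate G A" for g
    using that
  proof (induction rule: generate.induct)
    case (eng g h)
    then obtain us vs where "g = word_product G us" "us \<in> lists S" "us \<noteq> []"
      "h = word_product G vs" "vs \<in> lists S" "vs \<noteq> []"
      by blast
    then show ?case
      using word_product_append[OF S, of us vs] by (intro exI[of _ "us @ vs"]) simp
  next
    case one
    show ?case by (rule single) (simp add: S_def)
  next
    case (incl h)
    then show ?case by (intro single) (simp add: S_def)
  next
    case (inv h)
    then show ?case by (intro single) (simp add: S_def)
  qed
  then have "carrier G \<subseteq> {word_product G ws | ws. ws \<in> lists S \<and> ws \<noteq> []}"
    unfolding A(3) by (intro subsetI CollectI) simp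
  moreover have "{word_product G ws | ws. ws \<in> lists S \<and> ws \<noteq> []} \<subseteq> carrier G"
    using word_product_closed[OF S] by blast
  ultimately have "carrier G = {word_product G ws | ws. ws \<in> lists S \<and> ws \<noteq> []}"
    by (rule equalityI)
  with S have "semigroup_generating_set G S"
    unfolding semigroup_generating_set_def by (rule conjI)
  moreover have "finite S"
    using A(1) by (simp add: S_def)
  ultimately show ?thesis by blast
qed

section \<open>Growth of the Golod group\<close>

lemma module_of_int: "Modules.module (\<lambda>k (a :: 'r::ring_1). of_int k * a)"
  by unfold_locales (simp_all add: distrib_left distrib_right mult.assoc)

lemma constant_term_of_nat: "constant_term (of_nat k) = of_nat k"
  by (simp add: constant_term_def lookup_of_nat)

context golod
begin

context
  fixes S :: "('d, 'p) free_algebra set set"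
  assumes generating: "semigroup_generating_set G S"
begin

lemma S_subset: "S \<subseteq> carrier G"
  using generating unfolding semigroup_generating_set_def by (rule conjunct1)

interpretation Z: Modules.module "\<lambda>k (a :: ('d, 'p) free_algebra). of_int k * a"
  by (rule module_of_int)

text \<open>
  Lifts of the elements \<open>s - 1\<close> with \<open>s \<in> S\<close>.
\<close>

definition deviations :: "('d, 'p) free_algebra set"
  where "deviations = {t. constant_term t = 0 \<and> cls (1 + t) \<in> S}"

text \<open>
  Additive spans suffice in place of linear ones, the base field being prime. All lifts of an element
  of the ball are admitted, so that the span contains \<open>J\<close>.
\<close>

definition ball_span :: "nat \<Rightarrow> ('d, 'p) free_algebra set"
  where "ball_span n = Z.span {b. cls b \<in> word_ball G S n}"

text \<open>
  From \<open>a * b - 1 = (a - 1) + (b - 1) + (a - 1) * (b - 1)\<close>, where the last summand has order at least 2,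
  the linear part of a product is the sum of the linear parts of the factors.
\<close>

lemma word_product_linear_part:
  assumes "ws \<in> lists S"
  shows "\<exists>b t. cls b = word_product G ws \<and> constant_term b = 1
    \<and> t \<in> Z.span deviations \<and> order_at_least 2 (b - 1 - t)"
  using assms
proof (induction ws)
  case Nil
  show ?case
    by (intro exI[of _ 1] exI[of _ 0]) (simp add: word_product_def G_one Z.span_zero)
next
  case (Cons s ws)
  then obtain b t where b: "cls b = word_product G ws" "constant_term b = 1"
    and t: "t \<in> Z.span deviations" "order_at_least 2 (b - 1 - t)"
    by auto
  have s: "s \<in> carrier G"
    using Cons.hyps S_subset by blast
  have dev: "lift s - 1 \<in> deviations"
    using Cons.hyps constant_term_lift[OF s] cls_lift[OF s] by (simp add: deviations_def)
  have "order_at_least (Suc 0) (lift s - 1)" "order_at_least (Suc 0) (b - 1)"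
    unfolding order_at_least_1_iff using b(2) constant_term_lift[OF s] by simp_all
  then have "order_at_least (Suc 0 + Suc 0) ((lift s - 1) * (b - 1))"
    by (rule order_at_least_mult)
  then have "order_at_least 2 ((lift s - 1) * (b - 1))"
    by (simp add: numeral_2_eq_2)
  with t(2) have "order_at_least 2 ((b - 1 - t) + (lift s - 1) * (b - 1))"
    by (rule order_at_least_add)
  also have "(b - 1 - t) + (lift s - 1) * (b - 1) = lift s * b - 1 - ((lift s - 1) + t)"
    by (simp add: left_diff_distrib right_diff_distrib)
  finally have "order_at_least 2 (lift s * b - 1 - ((lift s - 1) + t))" .
  moreover have "(lift s - 1) + t \<in> Z.span deviations"
    by (rule Z.span_add[OF Z.span_base[OF dev] t(1)])
  moreover have "cls (lift s * b) = word_product G (s # ws)"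
    using b(1) cls_lift[OF s] by (simp add: word_product_def flip: B_mult)
  moreover have "constant_term (lift s * b) = 1"
    using b(2) constant_term_lift[OF s] by simp
  ultimately show ?case by blast
qed

text \<open>
  The group contains \<open>1 + gen i\<close>, whose linear part is \<open>gen i\<close>, and \<open>S\<close> generates the group; hence the
  linear parts of elements of \<open>S\<close> span all linear forms.
\<close>

lemma gen_linear_part: "\<exists>t\<in>Z.span deviations. order_at_least 2 (gen i - t)"
proof -
  have "golod_generator y l i \<in> carrier G"
    unfolding carrier_G by (intro generate.incl rangeI)
  then obtain ws where ws: "golod_generator y l i = word_product G ws" "ws \<in> lists S"
    using generating unfolding semigroup_generating_set_def by blast
  obtain b t where b: "cls b = word_product G ws" and t: "t \<in> Z.span deviations" "order_at_least 2 (b - 1 - t)"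
    using word_product_linear_part[OF ws(2)] by blast
  have "b - (1 + gen i) \<in> golod_ideal y l"
    using b ws(1) by (simp add: golod_generator_eq flip: cls_eq_iff)
  then have "order_at_least 2 (b - (1 + gen i))"
    by (rule order_at_least_mono[OF order_J]) simp
  with t(2) have "order_at_least 2 ((b - 1 - t) - (b - (1 + gen i)))"
    by (rule order_at_least_diff)
  then show ?thesis
    using t(1) by (intro bexI[of _ t]) (simp add: algebra_simps)
qed

lemma one_in_ball_span: "1 \<in> ball_span n"
  unfolding ball_span_def using one_in_word_ball[of G S n] by (intro Z.span_base) (simp add: G_one)

lemma ball_span_Suc: "ball_span n \<subseteq> ball_span (Suc n)"
  unfolding ball_span_def using word_ball_mono[of n "Suc n" G S] by (intro Z.span_mono) auto

lemma subspace_left_preimage: "Z.subspace {m. b * m \<in> ball_span n}"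
proof (rule Z.subspaceI)
  fix k a
  assume "a \<in> {m. b * m \<in> ball_span n}"
  then have "of_int k * (b * a) \<in> ball_span n"
    unfolding ball_span_def by (auto intro: Z.span_scale)
  moreover have "b * (of_int k * a) = of_int k * (b * a)"
    by (metis mult.assoc mult_of_int_commute)
  ultimately show "of_int k * a \<in> {m. b * m \<in> ball_span n}"
    by simp
qed (auto simp: ball_span_def distrib_left intro: Z.span_zero Z.span_add)

lemma subspace_right_preimage: "Z.subspace {t. t * m \<in> ball_span n}"
proof (rule Z.subspaceI)
  fix k a
  assume "a \<in> {t. t * m \<in> ball_span n}"
  then show "of_int k * a \<in> {t. t * m \<in> ball_span n}"
    unfolding ball_span_def by (auto intro: Z.span_scale simp: mult.assoc)
qed (auto simp: ball_span_def distrib_right intro: Z.span_zero Z.span_add)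

text \<open>
  Multiplication by \<open>s - 1\<close> is a difference of multiplication by \<open>s\<close>, which enlarges the radius of the
  ball by one, and of the identity.
\<close>

lemma deviation_mult_ball_span:
  assumes t: "t \<in> Z.span deviations" and m: "m \<in> ball_span n"
  shows "t * m \<in> ball_span (Suc n)"
proof -
  have lift_mult: "b * m \<in> ball_span (Suc n)" if "cls b \<in> S" for b
  proof -
    have "{b. cls b \<in> word_ball G S n} \<subseteq> {m. b * m \<in> ball_span (Suc n)}"
    proof
      fix c
      assume "c \<in> {b. cls b \<in> word_ball G S n}"
      then have "cls (b * c) \<in> word_ball G S (Suc n)"
        using word_ball_mult[OF that, of "cls c" G n] by (simp add: B_mult)
      then show "c \<in> {m. b * m \<in> ball_span (Suc n)}"
        unfolding ball_span_def by (simp add: Z.span_base)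
    qed
    then have "ball_span n \<subseteq> {m. b * m \<in> ball_span (Suc n)}"
      unfolding ball_span_def[of n] by (rule Z.span_minimal) (rule subspace_left_preimage)
    with m show ?thesis by blast
  qed
  have "deviations \<subseteq> {t. t * m \<in> ball_span (Suc n)}"
  proof
    fix t
    assume "t \<in> deviations"
    then have "(1 + t) * m \<in> ball_span (Suc n)"
      by (intro lift_mult) (simp add: deviations_def)
    moreover have "m \<in> ball_span (Suc n)"
      using m ball_span_Suc by blast
    ultimately have "(1 + t) * m - m \<in> ball_span (Suc n)"
      unfolding ball_span_def by (rule Z.span_diff)
    then show "t \<in> {t. t * m \<in> ball_span (Suc n)}"
      by (simp add: distrib_right)
  qed
  then have "Z.span deviations \<subseteq> {t. t * m \<in> ball_span (Suc n)}"
    by (rule Z.span_minimal) (rule subspace_right_preimage)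
  with t show ?thesis by blast
qed

text \<open>
  By induction on the degree: write \<open>a\<close> as \<open>\<Sum>j. gen j * a\<^sub>j\<close>, replace each \<open>gen j\<close> by a combination of deviations
  with the same linear part and each \<open>a\<^sub>j\<close> by an element of the previous span with the same leading part.
\<close>

lemma ball_span_leading_part:
  assumes "order_at_least n a"
  shows "\<exists>m\<in>ball_span n. order_at_least n m \<and> order_at_least (Suc n) (a - m)"
  using assms
proof (induction n arbitrary: a)
  case 0
  obtain k where k: "constant_term a = of_nat k"
    using surj_of_nat_mod_ring by blast
  have "of_int (int k) * 1 \<in> ball_span 0"
    using one_in_ball_span unfolding ball_span_def by (rule Z.span_scale)
  then have "of_nat k \<in> ball_span 0"
    by simp
  moreover have "order_at_least (Suc 0) (a - of_nat k)"
    unfolding order_at_least_1_iff by (simp add: k constant_term_of_nat)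
  ultimately show ?case
    by (intro bexI[of _ "of_nat k"]) simp_all
next
  case (Suc n)
  have ex_t: "\<forall>j. \<exists>t. t \<in> Z.span deviations \<and> order_at_least 2 (gen j - t)"
    using gen_linear_part by blast
  from choice[OF ex_t] obtain t
    where t: "\<And>j. t j \<in> Z.span deviations" "\<And>j. order_at_least 2 (gen j - t j)"
    by blast
  have ex_m: "\<forall>j. \<exists>m. m \<in> ball_span n \<and> order_at_least n m \<and> order_at_least (Suc n) (left_quotient j a - m)"
  proof
    fix j
    show "\<exists>m. m \<in> ball_span n \<and> order_at_least n m \<and> order_at_least (Suc n) (left_quotient j a - m)"
      using Suc.IH[OF left_quotient_order[OF Suc.prems, of j]] by blast
  qed
  from choice[OF ex_m] obtain m where m: "\<And>j. m j \<in> ball_span n" "\<And>j. order_at_least n (m j)"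
    "\<And>j. order_at_least (Suc n) (left_quotient j a - m j)"
    by blast
  let ?m = "\<Sum>j\<in>UNIV. t j * m j"
  have order_t: "order_at_least (Suc 0) (t j)" for j
  proof -
    have "order_at_least (Suc 0) (gen j - (gen j - t j))"
      by (rule order_at_least_diff[OF order_at_least_gen order_at_least_mono[OF t(2)]]) simp
    then show ?thesis by simp
  qed
  have "a = (\<Sum>j\<in>UNIV. gen j * left_quotient j a)"
    by (rule left_expansion_no_constant) (rule order_at_least_mono[OF Suc.prems], simp)
  then have "a - ?m = (\<Sum>j\<in>UNIV. gen j * left_quotient j a) - ?m"
    by (rule arg_cong)
  also have "\<dots> = (\<Sum>j\<in>UNIV. gen j * (left_quotient j a - m j) + (gen j - t j) * m j)"
    by (simp add: algebra_simps sum_subtractf)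
  finally have a_m: "a - ?m = (\<Sum>j\<in>UNIV. gen j * (left_quotient j a - m j) + (gen j - t j) * m j)" .
  have "order_at_least (Suc (Suc n)) (a - ?m)"
    unfolding a_m
  proof (intro order_at_least_sum order_at_least_add)
    fix j
    show "order_at_least (Suc (Suc n)) (gen j * (left_quotient j a - m j))"
      using order_at_least_mult[OF order_at_least_gen m(3)] by simp
    show "order_at_least (Suc (Suc n)) ((gen j - t j) * m j)"
      using order_at_least_mult[OF t(2) m(2)] by simp
  qed
  moreover have "order_at_least (Suc n) ?m"
    using order_at_least_mult[OF order_t m(2)] by (intro order_at_least_sum) simp
  moreover have "?m \<in> ball_span (Suc n)"
    using deviation_mult_ball_span[OF t(1) m(1)] unfolding ball_span_def by (intro Z.span_sum)
  ultimately show ?case by blast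
qed

text \<open>
  Leading parts are removed one degree at a time.
\<close>

lemma ball_span_truncation: "\<exists>m\<in>ball_span n. order_at_least (Suc n) (a - m)"
proof (induction n)
  case 0
  show ?case
    using ball_span_leading_part[of 0 a] by auto
next
  case (Suc n)
  then obtain m where m: "m \<in> ball_span n" "order_at_least (Suc n) (a - m)"
    by blast
  then obtain m' where m': "m' \<in> ball_span (Suc n)" "order_at_least (Suc (Suc n)) (a - m - m')"
    using ball_span_leading_part by blast
  have "m + m' \<in> ball_span (Suc n)"
    using m(1) m'(1) ball_span_Suc[of n] unfolding ball_span_def by (intro Z.span_add) auto
  then show ?case
    using m'(2) by (intro bexI[of _ "m + m'"]) (simp_all add: diff_diff_eq)
qed

lemma ball_span_coefficients:
  assumes "finite S" and m: "m \<in> ball_span n"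
  shows "\<exists>u. m - (\<Sum>g\<in>word_ball G S n. of_int (u g) * lift g) \<in> golod_ideal y l"
proof -
  let ?W = "word_ball G S n"
  let ?c = "\<lambda>u. \<Sum>g\<in>?W. of_int (u g :: int) * lift g"
  have fin: "finite ?W"
    by (rule finite_word_ball[OF assms(1)])
  have W: "?W \<subseteq> carrier G"
    by (rule monoid.word_ball_closed[OF group.is_monoid[OF group_G] S_subset])
  have "Z.subspace {m. \<exists>u. m - ?c u \<in> golod_ideal y l}"
  proof (rule Z.subspaceI)
    show "0 \<in> {m. \<exists>u. m - ?c u \<in> golod_ideal y l}"
      by (intro CollectI exI[of _ "\<lambda>_. 0"]) (simp add: ideal_zero[OF ideal])
  next
    fix a b
    assume "a \<in> {m. \<exists>u. m - ?c u \<in> golod_ideal y l}" "b \<in> {m. \<exists>u. m - ?c u \<in> golod_ideal y l}"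
    then obtain u v where uv: "a - ?c u \<in> golod_ideal y l" "b - ?c v \<in> golod_ideal y l"
      by blast
    have "(a - ?c u) + (b - ?c v) = a + b - ?c (\<lambda>g. u g + v g)"
      by (simp add: distrib_right sum.distrib)
    then have "a + b - ?c (\<lambda>g. u g + v g) \<in> golod_ideal y l"
      using ideal_add[OF ideal uv] by (rule subst)
    then show "a + b \<in> {m. \<exists>u. m - ?c u \<in> golod_ideal y l}"
      by (intro CollectI exI[of _ "\<lambda>g. u g + v g"])
  next
    fix k a
    assume "a \<in> {m. \<exists>u. m - ?c u \<in> golod_ideal y l}"
    then obtain u where u: "a - ?c u \<in> golod_ideal y l"
      by blast
    have "of_int k * (a - ?c u) = of_int k * a - ?c (\<lambda>g. k * u g)"
      unfolding right_diff_distrib sum_distrib_left of_int_mult mult.assoc ..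
    then have "of_int k * a - ?c (\<lambda>g. k * u g) \<in> golod_ideal y l"
      using ideal_mult_left[OF ideal u, of "of_int k"] by (rule subst)
    then show "of_int k * a \<in> {m. \<exists>u. m - ?c u \<in> golod_ideal y l}"
      by (intro CollectI exI[of _ "\<lambda>g. k * u g"])
  qed
  moreover have "{b. cls b \<in> ?W} \<subseteq> {m. \<exists>u. m - ?c u \<in> golod_ideal y l}"
  proof
    fix b
    assume "b \<in> {b. cls b \<in> ?W}"
    then have b: "cls b \<in> ?W" by simp
    let ?u = "\<lambda>g. if g = cls b then 1 else 0"
    have "?c ?u = (\<Sum>g\<in>?W. if g = cls b then lift g else 0)"
      by (rule sum.cong) simp_all
    also have "\<dots> = lift (cls b)"
      using b fin by simp
    finally have sum: "?c ?u = lift (cls b)" .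
    have "cls b = cls (lift (cls b))"
      by (rule cls_lift[OF subsetD[OF W b], symmetric])
    then have "b - lift (cls b) \<in> golod_ideal y l"
      unfolding cls_eq_iff .
    then have "b - ?c ?u \<in> golod_ideal y l"
      unfolding sum .
    then show "b \<in> {m. \<exists>u. m - ?c u \<in> golod_ideal y l}"
      by (intro CollectI exI[of _ ?u])
  qed
  ultimately have "ball_span n \<subseteq> {m. \<exists>u. m - ?c u \<in> golod_ideal y l}"
    unfolding ball_span_def by (intro Z.span_minimal)
  with m show ?thesis by blast
qed

lemma of_int_mod_CARD: "of_int (k mod int CARD('p)) = (of_int k :: ('d, 'p) free_algebra)"
proof -
  have "(of_int k :: ('d, 'p) free_algebra) = of_int (int CARD('p) * (k div int CARD('p)) + k mod int CARD('p))"
    by simp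
  also have "\<dots> = of_nat CARD('p) * of_int (k div int CARD('p)) + of_int (k mod int CARD('p))"
    by (simp only: of_int_add of_int_mult of_int_of_nat_eq)
  finally show ?thesis
    unfolding of_nat_CARD_free_algebra by simp
qed

text \<open>
  Modulo \<open>J\<close> and terms of degree above \<open>n\<close>, every representative is a combination of fixed lifts of the
  elements of the ball with coefficients in \<open>{0..<p}\<close>. The coefficients determine a representative, because
  the difference of two representatives is homogeneous of degree \<open>n\<close> and \<open>J\<close> is a homogeneous ideal.
\<close>

lemma card_reps_le_growth:
  assumes "finite S"
  shows "card (reps n) \<le> CARD('p) ^ growth_function G S n"
proof -
  let ?W = "word_ball G S n"
  let ?c = "\<lambda>u. \<Sum>g\<in>?W. of_int (u g :: int) * lift g"
  let ?U = "\<Pi>\<^sub>E g\<in>?W. {0..<int CARD('p)}"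
  let ?R = "\<lambda>c u. \<exists>m. order_at_least (Suc n) (c - m) \<and> m - ?c u \<in> golod_ideal y l"
  have fin: "finite ?W"
    by (rule finite_word_ball[OF assms])
  have p: "0 < int CARD('p)"
    using prime_gt_0_nat[OF prime_card[where 'a = 'p]] by simp
  have "card (reps n) \<le> card ?U"
  proof (rule card_le_if_separating_relation[where R = ?R])
    show "finite ?U"
      by (intro finite_PiE fin) simp
    fix c
    obtain m where m: "m \<in> ball_span n" "order_at_least (Suc n) (c - m)"
      using ball_span_truncation by blast
    obtain u where u: "m - ?c u \<in> golod_ideal y l"
      using ball_span_coefficients[OF assms m(1)] by blast
    let ?u = "\<lambda>g\<in>?W. u g mod int CARD('p)"
    have "?c ?u = ?c u"
      by (rule sum.cong) (simp_all add: of_int_mod_CARD)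
    then have "m - ?c ?u \<in> golod_ideal y l"
      using u by (simp only:)
    moreover have "?u \<in> ?U"
      using p by auto
    ultimately show "\<exists>u\<in>?U. ?R c u"
      using m(2) by blast
  next
    fix c c' u
    assume c: "c \<in> reps n" "c' \<in> reps n" and "?R c u" "?R c' u"
    then obtain m m' where m: "order_at_least (Suc n) (c - m)" "m - ?c u \<in> golod_ideal y l"
      and m': "order_at_least (Suc n) (c' - m')" "m' - ?c u \<in> golod_ideal y l"
      by blast
    let ?e = "(c - m) - (c' - m')" and ?j = "(m - ?c u) - (m' - ?c u)"
    have "homogeneous_part n ?e = 0"
      by (rule homogeneous_part_order_at_least[OF order_at_least_diff[OF m(1) m'(1)]]) simp
    moreover have "homogeneous_part n ?j \<in> golod_ideal y l"
      by (rule homogeneous_part_in_J[OF ideal_diff[OF ideal m(2) m'(2)]])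
    moreover have "homogeneous_part n (?e + ?j) = homogeneous_part n ?e + homogeneous_part n ?j"
      by (rule homogeneous_part_add)
    moreover have "?e + ?j = c - c'"
      by simp
    moreover have "homogeneous_part n (c - c') = c - c'"
      using homogeneous_part_homogeneous[OF homogeneous_diff[OF reps_homogeneous[OF c(1)] reps_homogeneous[OF c(2)]]]
      by simp
    ultimately have "c - c' \<in> golod_ideal y l"
      by simp
    then show "c = c'"
      by (rule reps_eqI[OF c])
  qed
  also have "card ?U = CARD('p) ^ card ?W"
    using fin by (simp add: card_PiE)
  finally show ?thesis
    by (simp add: growth_function_eq_card)
qed

lemma growth_rate_G:
  assumes "2 \<le> CARD('d)" "finite S"
  shows "3 / 2 \<le> growth_rate G S"
proof (rule monoid.growth_rate_ge[OF group.is_monoid[OF group_G] S_subset assms(2)])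
  fix n
  have p: "1 < real CARD('p)"
    using prime_gt_1_nat[OF prime_card[where 'a = 'p]] by simp
  have "(3 / 2) ^ n \<le> log CARD('p) (card (reps n))"
    by (rule reps_exponential_growth[OF assms(1)])
  also have "\<dots> \<le> log CARD('p) (CARD('p) ^ growth_function G S n)"
  proof (rule log_mono[OF p])
    have "0 < card (reps n)"
      using finite_reps[of n] by (auto simp: card_gt_0_iff reps_def homogeneous_def intro: exI[of _ 0])
    then show "0 < real (card (reps n))" by simp
    show "real (card (reps n)) \<le> real (CARD('p) ^ growth_function G S n)"
      using card_reps_le_growth[OF assms(2), of n] by (rule of_nat_mono)
  qed
  also have "\<dots> = real (growth_function G S n)"
    using p by (simp add: log_nat_power)
  finally show "(3 / 2) ^ n \<le> real (growth_function G S n)" .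
qed simp

end

text \<open>
  The lower bound \<open>3 / 2\<close> for the growth rate is the same for all generating sets.
\<close>

lemma uniformly_exponential_growth_G:
  assumes "2 \<le> CARD('d)"
  shows "uniformly_exponential_growth G"
proof -
  have "3 / 2 \<le> minimal_growth_rate G"
    unfolding minimal_growth_rate_def
  proof (rule cInf_greatest)
    show "{growth_rate G S | S. finite S \<and> semigroup_generating_set G S} \<noteq> {}"
      using group.finite_semigroup_generating_set[OF group_G finitely_generated_G] by blast
  qed (use growth_rate_G[OF _ assms] in blast)
  then show ?thesis
    using finitely_generated_G by (simp add: uniformly_exponential_growth_def)
qed

end

theorem theorem3p1:
  fixes y :: "nat \<Rightarrow> ('d::finite, 'p::prime_card) free_algebra"
    and l :: "nat \<Rightarrow> nat"
  assumes "CARD('d) \<ge> 2"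
    and "golod_data y l"
  shows "finitely_generated_group (golod_group y l)
    \<and> residually_finite_group (golod_group y l)
    \<and> p_group CARD('p) (golod_group y l)
    \<and> uniformly_exponential_growth (golod_group y l)"
proof -
  interpret golod y l
    by (rule golod.intro) (fact assms(2))
  show ?thesis
    using finitely_generated_G residually_finite_G p_group_G
      uniformly_exponential_growth_G[OF assms(1)] by blast
qed

end
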